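(* Let $F:(-1,1)\to\mathbb{C}$ be continuous and positive definite, let $T_F:L^2(0,1)\to\mathscr{H}_F$ be its Mercer operator, and let $f_n:=T_F(e_n)\in\mathscr{H}_F$, $n\in\mathbb{Z}$, where $e_n(x)=e^{i2\pi nx}$ (the system obtained by Shannon sampling in the Fourier domain). Then $\{f_n\}_{n\in\mathbb{Z}}$ is a Bessel frame in $\mathscr{H}_F$, and one may take as frame bound the largest eigenvalue $\lambda_1$ of the Mercer operator $T_F$ (as an operator in $L^2(0,1)$): $$\sum_{n\in\mathbb{Z}}\big|\langle f_n,\xi\rangle_{\mathscr{H}_F}\big|^2\le\lambda_1\,\|\xi\|^2_{\mathscr{H}_F},\qquad\text{for all }\xi\in\mathscr{H}_F .$$
   Context: $F:(-1,1)\to\mathbb{C}$ is positive definite if $\sum_{i,j}\overline{c_i}c_jF(x_i-x_j)\ge0$ for all finite systems $c_i\in\mathbb{C}$, $x_i\in(0,1)$. $\mathscr{H}_F$ is the reproducing kernel Hilbert space of continuous functions on $(0,1)$ obtained by completing the span of $F(\cdot-x)$, $x\in(0,1)$, in the inner product (conjugate linear in the first variable) $\langle F(\cdot-x),F(\cdot-y)\rangle=F(x-y)$. The Mercer operator is $(T_F\varphi)(x)=\int_0^1\varphi(y)F(x-y)\,dy$, $\varphi\in L^2(0,1)$; its values lie in $\mathscr{H}_F$, and regarded as an operator in $L^2(0,1)$ it is positive, selfadjoint and trace class. A system $\{f_n\}_{n\in\mathbb{Z}}\subset\mathscr{H}_F$ is a Bessel frame if there is a finite constant $A$ with $\sum_n|\langle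 f_n,\xi\rangle_{\mathscr{H}_F}|^2\le A\|\xi\|^2_{\mathscr{H}_F}$ for all $\xi\in\mathscr{H}_F$. *)

theory Defs
  imports "HOL-Analysis.Analysis"
begin

section \<open>Positive definite functions on \<open>(-1,1)\<close>\<close>

text \<open>Functions on an interval are total functions on the reals; the values of \<open>F\<close> outside
  \<open>(-1,1)\<close> are never used, since only differences of points of \<open>(0,1)\<close> occur.\<close>

definition positive_definite :: "(real \<Rightarrow> complex) \<Rightarrow> bool" where
  "positive_definite F \<longleftrightarrow>
     (\<forall>(n::nat) (c :: nat \<Rightarrow> complex) (x :: nat \<Rightarrow> real). (\<forall>i<n. x i \<in> {0<..<1}) \<longrightarrow>
        (\<Sum>i<n. \<Sum>j<n. cnj (c i) * c j * F (x i - x j)) \<in> \<real>\<^sub>\<ge>\<^sub>0)"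


section \<open>The reproducing kernel Hilbert space\<close>

text \<open>A coefficient function \<open>c\<close> stands for the finite linear combination
  \<open>\<Sum>\<^sub>x c(x) F(\<cdot> - x)\<close> of kernel sections, and \<open>gram F\<close> is the sesquilinear extension of
  \<open>\<langle>F(\<cdot> - x), F(\<cdot> - y)\<rangle> = F(x - y)\<close>, conjugate linear in the first variable.\<close>

definition supp :: "(real \<Rightarrow> complex) \<Rightarrow> real set" where
  "supp c = {x. c x \<noteq> 0}"

definition fin_coeffs :: "(real \<Rightarrow> complex) set" where
  "fin_coeffs = {c. finite (supp c) \<and> supp c \<subseteq> {0<..<1}}"

definition comb :: "(real \<Rightarrow> complex) \<Rightarrow> (real \<Rightarrow> complex) \<Rightarrow> real \<Rightarrow> complex" where
  "comb F c t = (\<Sum>x\<in>supp c. c x * F (t - x))"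

definition gram :: "(real \<Rightarrow> complex) \<Rightarrow> (real \<Rightarrow> complex) \<Rightarrow> (real \<Rightarrow> complex) \<Rightarrow> complex" where
  "gram F c d = (\<Sum>x\<in>supp c. \<Sum>y\<in>supp d. cnj (c x) * d y * F (x - y))"

text \<open>The completion is realized as a space of functions: norm-Cauchy sequences of the span
  converge pointwise on \<open>(0,1)\<close>, and the class of such a sequence is identified with its pointwise
  limit. Elements are normalized to vanish off \<open>(0,1)\<close>, so that equality of elements is equality
  of functions on \<open>(0,1)\<close>.\<close>

definition approximates :: "(real \<Rightarrow> complex) \<Rightarrow> (nat \<Rightarrow> real \<Rightarrow> complex) \<Rightarrow> (real \<Rightarrow> complex) \<Rightarrow> bool"
  where
  "approximates F C \<xi> \<longleftrightarrow>
     (\<forall>k. C k \<in> fin_coeffs) \<and>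
     (\<forall>\<epsilon>>0. \<exists>N. \<forall>m\<ge>N. \<forall>n\<ge>N. sqrt (Re (gram F (C m - C n) (C m - C n))) < \<epsilon>) \<and>
     (\<forall>t\<in>{0<..<1}. (\<lambda>k. comb F (C k) t) \<longlonglongrightarrow> \<xi> t)"

definition rkhs :: "(real \<Rightarrow> complex) \<Rightarrow> (real \<Rightarrow> complex) set" where
  "rkhs F = {\<xi>. (\<forall>t. t \<notin> {0<..<1} \<longrightarrow> \<xi> t = 0) \<and> (\<exists>C. approximates F C \<xi>)}"

text \<open>Well-definedness of the inner product is lemma \<open>rkhs_inner_tendsto\<close> below.\<close>

definition rkhs_inner :: "(real \<Rightarrow> complex) \<Rightarrow> (real \<Rightarrow> complex) \<Rightarrow> (real \<Rightarrow> complex) \<Rightarrow> complex" where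
  "rkhs_inner F \<xi> \<eta> = (THE z. \<forall>C D. approximates F C \<xi> \<longrightarrow> approximates F D \<eta> \<longrightarrow>
                              (\<lambda>k. gram F (C k) (D k)) \<longlonglongrightarrow> z)"

definition rkhs_norm :: "(real \<Rightarrow> complex) \<Rightarrow> (real \<Rightarrow> complex) \<Rightarrow> real" where
  "rkhs_norm F \<xi> = sqrt (Re (rkhs_inner F \<xi> \<xi>))"


section \<open>The Mercer operator\<close>

definition square_integrable01 :: "(real \<Rightarrow> complex) \<Rightarrow> bool" where
  "square_integrable01 \<phi> \<longleftrightarrow>
     \<phi> \<in> borel_measurable (lebesgue_on {0<..<1}) \<and>
     integrable (lebesgue_on {0<..<1}) (\<lambda>x. (cmod (\<phi> x))\<^sup>2)"

definition mercer :: "(real \<Rightarrow> complex) \<Rightarrow> (real \<Rightarrow> complex) \<Rightarrow> real \<Rightarrow> complex" where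
  "mercer F \<phi> x =
     (if x \<in> {0<..<1} then (LINT y | lebesgue_on {0<..<1}. \<phi> y * F (x - y)) else 0)"

text \<open>Eigenvalues in \<open>L\<^sup>2(0,1)\<close>: equality and nonvanishing are up to null sets.\<close>

definition mercer_eigenvalue :: "(real \<Rightarrow> complex) \<Rightarrow> complex \<Rightarrow> bool" where
  "mercer_eigenvalue F \<mu> \<longleftrightarrow>
     (\<exists>\<phi>. square_integrable01 \<phi> \<and>
          \<not> (AE x in lebesgue_on {0<..<1}. \<phi> x = 0) \<and>
          (AE x in lebesgue_on {0<..<1}. mercer F \<phi> x = \<mu> * \<phi> x))"

text \<open>The Mercer operator of a positive definite function is selfadjoint, so all its eigenvalues
  are real and comparing real parts is comparing eigenvalues.\<close>

definition largest_mercer_eigenvalue :: "(real \<Rightarrow> complex) \<Rightarrow> real \<Rightarrow> bool" where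
  "largest_mercer_eigenvalue F \<Lambda> \<longleftrightarrow>
     mercer_eigenvalue F (complex_of_real \<Lambda>) \<and>
     (\<forall>\<mu>. mercer_eigenvalue F \<mu> \<longrightarrow> Re \<mu> \<le> \<Lambda>)"


section \<open>Bessel frames and the sampled system\<close>

definition bessel_bound :: "(real \<Rightarrow> complex) \<Rightarrow> (int \<Rightarrow> real \<Rightarrow> complex) \<Rightarrow> real \<Rightarrow> bool" where
  "bessel_bound F f A \<longleftrightarrow>
     (\<forall>\<xi>\<in>rkhs F.
        (\<lambda>n. (cmod (rkhs_inner F (f n) \<xi>))\<^sup>2) summable_on UNIV \<and>
        (\<Sum>\<^sub>\<infinity>n. (cmod (rkhs_inner F (f n) \<xi>))\<^sup>2) \<le> A * (rkhs_norm F \<xi>)\<^sup>2)"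

definition bessel_frame :: "(real \<Rightarrow> complex) \<Rightarrow> (int \<Rightarrow> real \<Rightarrow> complex) \<Rightarrow> bool" where
  "bessel_frame F f \<longleftrightarrow> (\<forall>n. f n \<in> rkhs F) \<and> (\<exists>A. bessel_bound F f A)"

definition fourier_mode :: "int \<Rightarrow> real \<Rightarrow> complex" where
  "fourier_mode n x = exp (\<i> * of_real (2 * pi * of_int n * x))"

definition shannon_system :: "(real \<Rightarrow> complex) \<Rightarrow> int \<Rightarrow> real \<Rightarrow> complex" where
  "shannon_system F n = mercer F (fourier_mode n)"


section \<open>Well-definedness of the inner product\<close>

lemma gram_eq:
  assumes "finite S" "supp c \<subseteq> S" "finite T" "supp d \<subseteq> T"
  shows "gram F c d = (\<Sum>x\<in>S. \<Sum>y\<in>T. cnj (c x) * d y * F (x - y))"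
proof -
  have "(\<Sum>x\<in>S. \<Sum>y\<in>T. cnj (c x) * d y * F (x - y))
      = (\<Sum>x\<in>supp c. \<Sum>y\<in>T. cnj (c x) * d y * F (x - y))"
    using assms by (intro sum.mono_neutral_right) (auto simp: supp_def)
  also have "\<dots> = gram F c d"
    unfolding gram_def using assms
    by (intro sum.cong refl sum.mono_neutral_right) (auto simp: supp_def)
  finally show ?thesis by simp
qed

lemma comb_eq:
  assumes "finite S" "supp c \<subseteq> S"
  shows "comb F c t = (\<Sum>x\<in>S. c x * F (t - x))"
  unfolding comb_def using assms
  by (intro sum.mono_neutral_left) (auto simp: supp_def)

lemma gram_comb: "gram F c d = (\<Sum>x\<in>supp c. cnj (c x) * comb F d x)"
  unfolding gram_def comb_def by (simp add: sum_distrib_left mult.assoc)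

lemma supp_lin: "supp (\<lambda>x. c x + z * d x) \<subseteq> supp c \<union> supp d"
  by (auto simp: supp_def)

lemma fin_coeffs_lin:
  assumes "c \<in> fin_coeffs" "d \<in> fin_coeffs"
  shows "(\<lambda>x. c x + z * d x) \<in> fin_coeffs"
  using assms supp_lin[of c z d] finite_subset[OF supp_lin[of c z d]]
  by (auto simp: fin_coeffs_def)

lemma fin_coeffs_diff:
  assumes "c \<in> fin_coeffs" "d \<in> fin_coeffs"
  shows "c - d \<in> fin_coeffs"
  using fin_coeffs_lin[OF assms, of "-1"] by (simp add: fun_diff_def)

lemma comb_lin:
  assumes "c \<in> fin_coeffs" "d \<in> fin_coeffs"
  shows "comb F (\<lambda>x. c x + z * d x) t = comb F c t + z * comb F d t"
proof -
  let ?S = "supp c \<union> supp d"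
  have f: "finite ?S" using assms by (auto simp: fin_coeffs_def)
  show ?thesis
    by (simp add: comb_eq[OF f supp_lin] comb_eq[OF f, of c] comb_eq[OF f, of d]
        algebra_simps sum.distrib sum_distrib_left)
qed

lemma comb_diff:
  assumes "c \<in> fin_coeffs" "d \<in> fin_coeffs"
  shows "comb F (c - d) t = comb F c t - comb F d t"
  using comb_lin[OF assms, of F "-1" t] by (simp add: fun_diff_def)

lemma gram_lin_right:
  assumes "d \<in> fin_coeffs" "e \<in> fin_coeffs"
  shows "gram F c (\<lambda>x. d x + z * e x) = gram F c d + z * gram F c e"
  by (simp add: gram_comb comb_lin[OF assms] algebra_simps sum.distrib sum_distrib_left)

lemma gram_lin_left:
  assumes "c \<in> fin_coeffs" "d \<in> fin_coeffs"
  shows "gram F (\<lambda>x. c x + z * d x) e = gram F c e + cnj z * gram F d e"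
proof -
  let ?S = "supp c \<union> supp d"
  have f: "finite ?S" using assms by (auto simp: fin_coeffs_def)
  have *: "gram F b e = (\<Sum>x\<in>?S. cnj (b x) * comb F e x)" if "supp b \<subseteq> ?S" for b
    unfolding gram_comb using that f
    by (intro sum.mono_neutral_left) (auto simp: supp_def)
  show ?thesis
    by (simp add: *[OF supp_lin] *[of c] *[of d] algebra_simps sum.distrib sum_distrib_left)
qed

lemma gram_diff_right:
  assumes "d \<in> fin_coeffs" "e \<in> fin_coeffs"
  shows "gram F c (d - e) = gram F c d - gram F c e"
  using gram_lin_right[OF assms, of F c "-1"] by (simp add: fun_diff_def)

lemma gram_diff_left:
  assumes "c \<in> fin_coeffs" "d \<in> fin_coeffs"
  shows "gram F (c - d) e = gram F c e - gram F d e"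
  using gram_lin_left[OF assms, of F "-1" e] by (simp add: fun_diff_def)

lemma gram_nonneg:
  assumes F: "positive_definite F" and c: "c \<in> fin_coeffs"
  shows "gram F c c \<in> \<real>\<^sub>\<ge>\<^sub>0"
proof -
  have fin: "finite (supp c)" and sub: "supp c \<subseteq> {0<..<1}"
    using c by (auto simp: fin_coeffs_def)
  from ex_bij_betw_nat_finite[OF fin] obtain h where
    h: "bij_betw h {..<card (supp c)} (supp c)" by (auto simp: atLeast0LessThan)
  have "\<forall>i<card (supp c). h i \<in> {0<..<1}"
  proof (intro allI impI)
    fix i assume "i < card (supp c)"
    hence "h i \<in> supp c" using bij_betwE[OF h] by auto
    with sub show "h i \<in> {0<..<1}" by blast
  qed
  hence "(\<Sum>i<card (supp c). \<Sum>j<card (supp c). cnj (c (h i)) * c (h j) * F (h i - h j)) \<in> \<real>\<^sub>\<ge>\<^sub>0"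
    using F[unfolded positive_definite_def, rule_format, of "card (supp c)" h "\<lambda>i. c (h i)"] by simp
  also have "(\<Sum>i<card (supp c). \<Sum>j<card (supp c). cnj (c (h i)) * c (h j) * F (h i - h j))
      = (\<Sum>i<card (supp c). \<Sum>y\<in>supp c. cnj (c (h i)) * c y * F (h i - y))"
    by (intro sum.cong refl sum.reindex_bij_betw[OF h])
  also have "\<dots> = gram F c c"
    unfolding gram_def by (rule sum.reindex_bij_betw[OF h])
  finally show ?thesis .
qed

lemma gram_expand:
  assumes "c \<in> fin_coeffs" "d \<in> fin_coeffs"
  shows "gram F (\<lambda>x. c x + z * d x) (\<lambda>x. c x + z * d x) =
    gram F c c + z * gram F c d + cnj z * gram F d c + cnj z * z * gram F d d"
  by (simp add: gram_lin_right[OF assms] gram_lin_left[OF assms] algebra_simps)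

lemma gram_cnj:
  assumes F: "positive_definite F" and c: "c \<in> fin_coeffs" and d: "d \<in> fin_coeffs"
  shows "gram F d c = cnj (gram F c d)"
proof -
  have im: "Im (gram F b b) = 0" if "b \<in> fin_coeffs" for b
    using gram_nonneg[OF F that] by (auto simp: complex_nonneg_Reals_iff)
  have "Im (gram F c c + z * gram F c d + cnj z * gram F d c + cnj z * z * gram F d d) = 0" for z
    using im[OF fin_coeffs_lin[OF c d, of z]] unfolding gram_expand[OF c d] .
  from this[of 1] this[of \<i>] im[OF c] im[OF d] show ?thesis
    by (auto simp: complex_eq_iff)
qed

lemma gram_cauchy_schwarz:
  assumes F: "positive_definite F" and c: "c \<in> fin_coeffs" and d: "d \<in> fin_coeffs"
  shows "cmod (gram F c d) \<le> sqrt (Re (gram F c c)) * sqrt (Re (gram F d d))"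
proof -
  define a b g where "a = Re (gram F c c)" and "b = Re (gram F d d)" and "g = cmod (gram F c d)"
  have nn: "0 \<le> Re (gram F e e)" if "e \<in> fin_coeffs" for e
    using gram_nonneg[OF F that] by (auto simp: complex_nonneg_Reals_iff)
  have a: "0 \<le> a" and b: "0 \<le> b" using nn c d by (auto simp: a_def b_def)
  have sq: "gram F c d * cnj (gram F c d) = of_real (g\<^sup>2)"
    by (simp only: g_def complex_norm_square)
  have quad: "0 \<le> a - 2 * t * g\<^sup>2 + t\<^sup>2 * g\<^sup>2 * b" for t
  proof -
    let ?z = "of_real (- t) * cnj (gram F c d)"
    have 1: "?z * gram F c d = of_real (- t * g\<^sup>2)"
    proof -
      have "?z * gram F c d = of_real (- t) * (gram F c d * cnj (gram F c d))"
        by (simp only: mult_ac)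
      thus ?thesis unfolding sq by simp
    qed
    have 2: "cnj ?z * gram F d c = of_real (- t * g\<^sup>2)"
    proof -
      have "cnj ?z * gram F d c = of_real (- t) * (gram F c d * cnj (gram F c d))"
        unfolding gram_cnj[OF F c d] by simp
      thus ?thesis unfolding sq by simp
    qed
    have 3: "cnj ?z * ?z = of_real (t\<^sup>2 * g\<^sup>2)"
    proof -
      have "cnj ?z * ?z = (of_real (- t) * of_real (- t)) * (gram F c d * cnj (gram F c d))"
        by (simp only: complex_cnj_mult complex_cnj_complex_of_real complex_cnj_cnj mult_ac)
      thus ?thesis unfolding sq by (simp add: power2_eq_square)
    qed
    have "0 \<le> Re (gram F c c + ?z * gram F c d + cnj ?z * gram F d c + cnj ?z * ?z * gram F d d)"
      using nn[OF fin_coeffs_lin[OF c d, of ?z]] unfolding gram_expand[OF c d] .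
    thus ?thesis unfolding 1 2 3 by (simp add: a_def b_def)
  qed
  have "g\<^sup>2 \<le> a * b"
  proof (cases "b = 0")
    case True
    show ?thesis
    proof (rule ccontr)
      assume "\<not> ?thesis"
      hence "g\<^sup>2 > 0" using True by simp
      with quad[of "(a + 1) / (2 * g\<^sup>2)"] True a show False by (simp add: field_simps)
    qed
  next
    case False
    with b have "b > 0" by simp
    have "0 \<le> a - g\<^sup>2 / b"
      using quad[of "1 / b"] \<open>b > 0\<close> by (simp add: field_simps power2_eq_square)
    thus ?thesis using \<open>b > 0\<close> by (simp add: field_simps)
  qed
  hence "g \<le> sqrt (a * b)" by (rule real_le_rsqrt)
  thus ?thesis by (simp add: a_def b_def g_def real_sqrt_mult)
qed

abbreviation gnorm :: "(real \<Rightarrow> complex) \<Rightarrow> (real \<Rightarrow> complex) \<Rightarrow> real" where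
  "gnorm F c \<equiv> sqrt (Re (gram F c c))"

lemma approximates_bounded:
  assumes F: "positive_definite F" and A: "approximates F C \<xi>"
  obtains K where "K > 0" "\<And>k. gnorm F (C k) \<le> K"
proof -
  have C: "C k \<in> fin_coeffs" for k using A by (simp add: approximates_def)
  obtain N where N: "\<And>m. m \<ge> N \<Longrightarrow> gnorm F (C m - C N) < 1"
    using A unfolding approximates_def by (meson order_refl zero_less_one)
  have nn: "0 \<le> Re (gram F e e)" if "e \<in> fin_coeffs" for e
    using gram_nonneg[OF F that] by (auto simp: complex_nonneg_Reals_iff)
  have tri: "gnorm F (C m) \<le> gnorm F (C N) + 1" if "m \<ge> N" for m
  proof -
    let ?D = "C m - C N"
    have D: "?D \<in> fin_coeffs" using C fin_coeffs_diff by blast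
    have 1: "gram F (C m) (C m)
        = gram F ?D ?D + gram F ?D (C N) + gram F (C N) ?D + gram F (C N) (C N)"
      by (simp add: gram_diff_left[OF C C] gram_diff_right[OF C C])
    have "Re (gram F ?D (C N)) \<le> gnorm F ?D * gnorm F (C N)"
      using gram_cauchy_schwarz[OF F D C] complex_Re_le_cmod order_trans by blast
    moreover have "Re (gram F (C N) ?D) \<le> gnorm F (C N) * gnorm F ?D"
      using gram_cauchy_schwarz[OF F C D] complex_Re_le_cmod order_trans by blast
    moreover have "(gnorm F (C N))\<^sup>2 = Re (gram F (C N) (C N))" "(gnorm F ?D)\<^sup>2 = Re (gram F ?D ?D)"
      using nn C D by auto
    moreover have "Re (gram F (C m) (C m)) = Re (gram F ?D ?D) + Re (gram F ?D (C N))
        + Re (gram F (C N) ?D) + Re (gram F (C N) (C N))"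
      unfolding 1 by simp
    moreover have "(gnorm F (C N) + gnorm F ?D)\<^sup>2 = (gnorm F (C N))\<^sup>2 + (gnorm F ?D)\<^sup>2
        + gnorm F (C N) * gnorm F ?D + gnorm F ?D * gnorm F (C N)"
      unfolding power2_sum by simp
    ultimately have "Re (gram F (C m) (C m)) \<le> (gnorm F (C N) + gnorm F ?D)\<^sup>2"
      by linarith
    hence "gnorm F (C m) \<le> gnorm F (C N) + gnorm F ?D"
      using nn[OF C] nn[OF D] by (intro real_le_lsqrt) auto
    with N[OF that] show ?thesis by linarith
  qed
  define K where "K = Max ((\<lambda>k. gnorm F (C k)) ` {..N}) + 1"
  have le: "gnorm F (C k) \<le> K - 1" if "k \<le> N" for k
    unfolding K_def using that by (auto intro!: Max_ge)
  have "gnorm F (C k) \<le> K" for k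
    using le[of k] le[of N] tri[of k] by (cases "k \<le> N") auto
  moreover have "K > 0" using le[of N] nn[OF C, of N] real_sqrt_ge_zero[OF nn[OF C, of N]] by linarith
  ultimately show ?thesis using that by blast
qed

lemma approximates_gram_tendsto:
  assumes A: "approximates F C \<xi>" and e: "e \<in> fin_coeffs"
  shows "(\<lambda>k. gram F e (C k)) \<longlonglongrightarrow> (\<Sum>x\<in>supp e. cnj (e x) * \<xi> x)"
  unfolding gram_comb using A e
  by (intro tendsto_sum tendsto_mult tendsto_const) (auto simp: approximates_def fin_coeffs_def)

lemma gnorm_tendsto_0:
  assumes F: "positive_definite F" and A: "approximates F C \<xi>" and B: "approximates F D \<xi>"
  shows "(\<lambda>k. gnorm F (C k - D k)) \<longlonglongrightarrow> 0"
proof -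
  have C: "C k \<in> fin_coeffs" and D: "D k \<in> fin_coeffs" for k
    using A B by (auto simp: approximates_def)
  have nn: "0 \<le> Re (gram F e e)" if "e \<in> fin_coeffs" for e
    using gram_nonneg[OF F that] by (auto simp: complex_nonneg_Reals_iff)
  define E where "E k = C k - D k" for k
  have E: "E k \<in> fin_coeffs" for k using C D fin_coeffs_diff by (simp add: E_def)
  obtain K1 where K1: "K1 > 0" "\<And>k. gnorm F (C k) \<le> K1" using approximates_bounded[OF F A] by metis
  obtain K2 where K2: "K2 > 0" "\<And>k. gnorm F (D k) \<le> K2" using approximates_bounded[OF F B] by metis
  define K where "K = K1 + K2"
  have K: "K > 0" using K1 K2 by (simp add: K_def)
  have "(\<lambda>k. Re (gram F (E k) (E k))) \<longlonglongrightarrow> 0"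
  proof (rule LIMSEQ_I)
    fix r :: real assume r: "r > 0"
    define \<epsilon> where "\<epsilon> = r / (4 * K)"
    have \<epsilon>: "\<epsilon> > 0" using r K by (simp add: \<epsilon>_def)
    obtain N1 where N1: "\<And>m n. m \<ge> N1 \<Longrightarrow> n \<ge> N1 \<Longrightarrow> gnorm F (C m - C n) < \<epsilon>"
      using A \<epsilon> unfolding approximates_def by meson
    obtain N2 where N2: "\<And>m n. m \<ge> N2 \<Longrightarrow> n \<ge> N2 \<Longrightarrow> gnorm F (D m - D n) < \<epsilon>"
      using B \<epsilon> unfolding approximates_def by meson
    define N where "N = max N1 N2"
    have "(\<lambda>k. gram F (E N) (C k) - gram F (E N) (D k)) \<longlonglongrightarrow> 0"
      using tendsto_diff[OF approximates_gram_tendsto[OF A E[of N]] approximates_gram_tendsto[OF B E[of N]]]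
      by simp
    from LIMSEQ_D[OF this, of "r / 2"] r obtain M where
      M: "\<And>k. k \<ge> M \<Longrightarrow> cmod (gram F (E N) (C k) - gram F (E N) (D k)) < r / 2" by auto
    have "norm (Re (gram F (E k) (E k)) - 0) < r" if k: "k \<ge> max N M" for k
    proof -
      have cd: "C k - C N \<in> fin_coeffs" "D k - D N \<in> fin_coeffs"
        using C D fin_coeffs_diff by blast+
      have split: "gram F (E k) (E k) = (gram F (E N) (C k) - gram F (E N) (D k))
          + (gram F (C k - C N) (C k) - gram F (C k - C N) (D k)
             - gram F (D k - D N) (C k) + gram F (D k - D N) (D k))"
        unfolding E_def
        by (simp add: gram_diff_left[OF C C] gram_diff_left[OF D D] gram_diff_left[OF C D]
            gram_diff_right[OF C D])
      have cs: "cmod (gram F e f) \<le> \<epsilon> * L"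
        if "gnorm F e < \<epsilon>" "gnorm F f \<le> L" "e \<in> fin_coeffs" "f \<in> fin_coeffs" for e f L
      proof -
        have "cmod (gram F e f) \<le> gnorm F e * gnorm F f"
          using gram_cauchy_schwarz[OF F] that by blast
        also have "\<dots> \<le> \<epsilon> * L" using that \<epsilon> nn[of f] by (intro mult_mono) auto
        finally show ?thesis .
      qed
      have b: "gnorm F (C k - C N) < \<epsilon>" "gnorm F (D k - D N) < \<epsilon>"
        using N1[of k N] N2[of k N] k by (auto simp: N_def)
      have "cmod (gram F (C k - C N) (C k) - gram F (C k - C N) (D k)
             - gram F (D k - D N) (C k) + gram F (D k - D N) (D k))
          \<le> \<epsilon> * K1 + \<epsilon> * K2 + \<epsilon> * K1 + \<epsilon> * K2"
        by (intro norm_triangle_le norm_triangle_le_diff add_mono cs b K1 K2 cd C D)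
      also have "\<dots> = 2 * (\<epsilon> * K)" by (simp add: K_def algebra_simps)
      also have "\<dots> = r / 2" using K by (simp add: \<epsilon>_def)
      finally have "cmod (gram F (E k) (E k)) < r"
        unfolding split using M[of k] k by (intro norm_triangle_lt) auto
      thus ?thesis using abs_Re_le_cmod[of "gram F (E k) (E k)"] by simp
    qed
    thus "\<exists>no. \<forall>n\<ge>no. norm (Re (gram F (E n) (E n)) - 0) < r" by blast
  qed
  from tendsto_real_sqrt[OF this] show ?thesis by (simp add: E_def)
qed

lemma approximates_gram_convergent:
  assumes F: "positive_definite F" and A: "approximates F C \<xi>" and B: "approximates F D \<eta>"
  shows "convergent (\<lambda>k. gram F (C k) (D k))"
proof -
  have C: "C k \<in> fin_coeffs" and D: "D k \<in> fin_coeffs" for k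
    using A B by (auto simp: approximates_def)
  have nn: "0 \<le> Re (gram F e e)" if "e \<in> fin_coeffs" for e
    using gram_nonneg[OF F that] by (auto simp: complex_nonneg_Reals_iff)
  obtain K1 where K1: "K1 > 0" "\<And>k. gnorm F (C k) \<le> K1" using approximates_bounded[OF F A] by metis
  obtain K2 where K2: "K2 > 0" "\<And>k. gnorm F (D k) \<le> K2" using approximates_bounded[OF F B] by metis
  have "Cauchy (\<lambda>k. gram F (C k) (D k))"
  proof (rule CauchyI)
    fix r :: real assume r: "r > 0"
    define \<epsilon> where "\<epsilon> = r / (2 * (K1 + K2))"
    have \<epsilon>: "\<epsilon> > 0" using r K1 K2 by (simp add: \<epsilon>_def)
    obtain N1 where N1: "\<And>m n. m \<ge> N1 \<Longrightarrow> n \<ge> N1 \<Longrightarrow> gnorm F (C m - C n) < \<epsilon>"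
      using A \<epsilon> unfolding approximates_def by meson
    obtain N2 where N2: "\<And>m n. m \<ge> N2 \<Longrightarrow> n \<ge> N2 \<Longrightarrow> gnorm F (D m - D n) < \<epsilon>"
      using B \<epsilon> unfolding approximates_def by meson
    have "norm (gram F (C m) (D m) - gram F (C n) (D n)) < r"
      if mn: "m \<ge> max N1 N2" "n \<ge> max N1 N2" for m n
    proof -
      have cd: "C m - C n \<in> fin_coeffs" "D m - D n \<in> fin_coeffs"
        using C D fin_coeffs_diff by blast+
      have eq: "gram F (C m) (D m) - gram F (C n) (D n)
          = gram F (C m - C n) (D m) + gram F (C n) (D m - D n)"
        by (simp add: gram_diff_left[OF C C] gram_diff_right[OF D D])
      have "cmod (gram F (C m - C n) (D m)) \<le> gnorm F (C m - C n) * gnorm F (D m)"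
        by (intro gram_cauchy_schwarz F cd D)
      also have "\<dots> \<le> \<epsilon> * K2"
        using \<epsilon> N1[of m n] mn K2(2)[of m] nn[OF D, of m] by (intro mult_mono) auto
      finally have 1: "cmod (gram F (C m - C n) (D m)) \<le> \<epsilon> * K2" .
      have "cmod (gram F (C n) (D m - D n)) \<le> gnorm F (C n) * gnorm F (D m - D n)"
        by (intro gram_cauchy_schwarz F cd C)
      also have "\<dots> \<le> K1 * \<epsilon>"
        using \<epsilon> N2[of m n] mn K1 nn[OF cd(2)] by (intro mult_mono) auto
      finally have 2: "cmod (gram F (C n) (D m - D n)) \<le> K1 * \<epsilon>" .
      have "cmod (gram F (C m) (D m) - gram F (C n) (D n)) \<le> \<epsilon> * K2 + K1 * \<epsilon>"
        unfolding eq by (intro norm_triangle_le add_mono 1 2)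
      also have "\<dots> = \<epsilon> * (K1 + K2)" by (simp add: algebra_simps)
      also have "\<dots> = r / 2"
      proof -
        have "K1 + K2 \<noteq> 0" using K1(1) K2(1) by simp
        thus ?thesis unfolding \<epsilon>_def by (simp del: distrib_left_numeral)
      qed
      finally show ?thesis using r by simp
    qed
    thus "\<exists>M. \<forall>m\<ge>M. \<forall>n\<ge>M. norm (gram F (C m) (D m) - gram F (C n) (D n)) < r" by blast
  qed
  thus ?thesis by (simp add: Cauchy_convergent_iff)
qed

lemma approximates_gram_unique:
  assumes F: "positive_definite F"
    and A: "approximates F C \<xi>" "approximates F C' \<xi>"
    and B: "approximates F D \<eta>" "approximates F D' \<eta>"
  shows "(\<lambda>k. gram F (C k) (D k) - gram F (C' k) (D' k)) \<longlonglongrightarrow> 0"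
proof -
  have m: "C k \<in> fin_coeffs" "C' k \<in> fin_coeffs" "D k \<in> fin_coeffs" "D' k \<in> fin_coeffs" for k
    using A B by (auto simp: approximates_def)
  have nn: "0 \<le> Re (gram F e e)" if "e \<in> fin_coeffs" for e
    using gram_nonneg[OF F that] by (auto simp: complex_nonneg_Reals_iff)
  obtain K1 where K1: "K1 > 0" "\<And>k. gnorm F (C' k) \<le> K1"
    using approximates_bounded[OF F A(2)] by metis
  obtain K2 where K2: "K2 > 0" "\<And>k. gnorm F (D k) \<le> K2"
    using approximates_bounded[OF F B(1)] by metis
  show ?thesis
  proof (rule Lim_null_comparison)
    show "(\<lambda>k. gnorm F (C k - C' k) * K2 + K1 * gnorm F (D k - D' k)) \<longlonglongrightarrow> 0"
      using tendsto_add[OF tendsto_mult_right[OF gnorm_tendsto_0[OF F A], of K2]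
          tendsto_mult_left[OF gnorm_tendsto_0[OF F B], of K1]]
      by simp
    show "\<forall>\<^sub>F k in sequentially. norm (gram F (C k) (D k) - gram F (C' k) (D' k))
        \<le> gnorm F (C k - C' k) * K2 + K1 * gnorm F (D k - D' k)"
    proof (intro always_eventually allI)
      fix k
      have cd: "C k - C' k \<in> fin_coeffs" "D k - D' k \<in> fin_coeffs"
        using m fin_coeffs_diff by blast+
      have eq: "gram F (C k) (D k) - gram F (C' k) (D' k)
          = gram F (C k - C' k) (D k) + gram F (C' k) (D k - D' k)"
        by (simp add: gram_diff_left m gram_diff_right)
      have "cmod (gram F (C k - C' k) (D k)) \<le> gnorm F (C k - C' k) * gnorm F (D k)"
        by (intro gram_cauchy_schwarz F cd m)
      also have "\<dots> \<le> gnorm F (C k - C' k) * K2"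
        using K2 nn[OF cd(1)] by (intro mult_left_mono) auto
      finally have 1: "cmod (gram F (C k - C' k) (D k)) \<le> gnorm F (C k - C' k) * K2" .
      have "cmod (gram F (C' k) (D k - D' k)) \<le> gnorm F (C' k) * gnorm F (D k - D' k)"
        by (intro gram_cauchy_schwarz F cd m)
      also have "\<dots> \<le> K1 * gnorm F (D k - D' k)"
        using K1 nn[OF cd(2)] by (intro mult_right_mono) auto
      finally have 2: "cmod (gram F (C' k) (D k - D' k)) \<le> K1 * gnorm F (D k - D' k)" .
      show "norm (gram F (C k) (D k) - gram F (C' k) (D' k))
          \<le> gnorm F (C k - C' k) * K2 + K1 * gnorm F (D k - D' k)"
        unfolding eq by (intro norm_triangle_le add_mono 1 2)
    qed
  qed
qed

lemma rkhs_inner_tendsto: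
  assumes F: "positive_definite F" and A: "approximates F C \<xi>" and B: "approximates F D \<eta>"
  shows "(\<lambda>k. gram F (C k) (D k)) \<longlonglongrightarrow> rkhs_inner F \<xi> \<eta>"
proof -
  obtain z where z: "(\<lambda>k. gram F (C k) (D k)) \<longlonglongrightarrow> z"
    using approximates_gram_convergent[OF F A B] by (auto simp: convergent_def)
  have all: "\<forall>C' D'. approximates F C' \<xi> \<longrightarrow> approximates F D' \<eta> \<longrightarrow>
      (\<lambda>k. gram F (C' k) (D' k)) \<longlonglongrightarrow> z"
  proof (intro allI impI)
    fix C' D' assume A': "approximates F C' \<xi>" and B': "approximates F D' \<eta>"
    show "(\<lambda>k. gram F (C' k) (D' k)) \<longlonglongrightarrow> z"
      using tendsto_add[OF approximates_gram_unique[OF F A' A B' B] z] by simp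
  qed
  have "rkhs_inner F \<xi> \<eta> = z"
    unfolding rkhs_inner_def
  proof (rule the_equality)
    show "\<forall>C' D'. approximates F C' \<xi> \<longrightarrow> approximates F D' \<eta> \<longrightarrow>
      (\<lambda>k. gram F (C' k) (D' k)) \<longlonglongrightarrow> z" by (fact all)
  next
    fix w
    assume "\<forall>C' D'. approximates F C' \<xi> \<longrightarrow> approximates F D' \<eta> \<longrightarrow>
      (\<lambda>k. gram F (C' k) (D' k)) \<longlonglongrightarrow> w"
    hence "(\<lambda>k. gram F (C k) (D k)) \<longlonglongrightarrow> w" using A B by blast
    thus "w = z" using z LIMSEQ_unique by blast
  qed
  with z show ?thesis by simp
qed

definition kernel_section :: "(real \<Rightarrow> complex) \<Rightarrow> real \<Rightarrow> real \<Rightarrow> complex" where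
  "kernel_section F x t = (if t \<in> {0<..<1} then F (t - x) else 0)"

lemma approximates_kernel_section:
  assumes "x \<in> {0<..<1}"
  shows "approximates F (\<lambda>_. indicator {x}) (kernel_section F x)"
proof -
  have s: "supp (indicator {x}) = {x}" by (auto simp: supp_def indicator_def)
  have "supp (indicator {x} - indicator {x}) = {}" by (auto simp: supp_def)
  thus ?thesis using assms s
    by (auto simp: approximates_def fin_coeffs_def comb_def gram_def kernel_section_def)
qed

lemma kernel_section_in_rkhs:
  assumes "x \<in> {0<..<1}"
  shows "kernel_section F x \<in> rkhs F"
  using approximates_kernel_section[OF assms] by (auto simp: rkhs_def kernel_section_def)

lemma rkhs_reproducing:
  assumes F: "positive_definite F" and x: "x \<in> {0<..<1}" and \<xi>: "\<xi> \<in> rkhs F"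
  shows "rkhs_inner F (kernel_section F x) \<xi> = \<xi> x"
proof -
  obtain D where D: "approximates F D \<xi>" using \<xi> by (auto simp: rkhs_def)
  have s: "supp (indicator {x}) = {x}" by (auto simp: supp_def indicator_def)
  have "(\<lambda>k. gram F (indicator {x}) (D k)) \<longlonglongrightarrow> \<xi> x"
    using D x by (simp add: gram_comb s approximates_def)
  thus ?thesis
    using rkhs_inner_tendsto[OF F approximates_kernel_section[OF x] D] LIMSEQ_unique by blast
qed

end

theory Submission
  imports Defs "HOL-Complex_Analysis.Great_Picard"
begin

text \<open>The Mercer operator \<open>T = T\<^sub>F\<close>, regarded as a map from \<open>L\<^sup>2(0,1)\<close> to the Hilbert space \<open>H\<close> of the
  kernel, is the adjoint of the inclusion of \<open>H\<close> into \<open>L\<^sup>2(0,1)\<close>: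
  \<open>\<langle>T \<phi>, \<xi>\<rangle>\<^sub>H = \<integral> cnj (\<phi> x) \<xi>(x) dx\<close> (lemma \<open>rkhs_inner_mercer\<close>). It is proved by approximating \<open>T \<phi>\<close> by
  midpoint sums, which are finite combinations of kernel sections. With \<open>\<phi> = e\<^sub>n\<close> the coefficients
  \<open>\<langle>f\<^sub>n, \<xi>\<rangle>\<^sub>H\<close> turn out to be the Fourier coefficients of \<open>\<xi>\<close> on \<open>(0,1)\<close>, and Bessel's inequality bounds
  their square sum by the squared \<open>L\<^sup>2\<close> norm of \<open>\<xi>\<close>. It remains to compare the two norms of \<open>\<xi>\<close>.

  Let \<open>\<lambda>\<close> be the supremum of the quadratic form \<open>\<langle>\<phi>, T \<phi>\<rangle>\<close> over the unit ball of \<open>L\<^sup>2(0,1)\<close>. By the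
  adjointness, \<open>\<parallel>\<xi>\<parallel>\<^sup>2 = \<langle>T \<xi>, \<xi>\<rangle>\<^sub>H\<close> in \<open>L\<^sup>2\<close> and \<open>\<parallel>T \<xi>\<parallel>\<^sub>H\<^sup>2 = \<langle>\<xi>, T \<xi>\<rangle> \<le> \<lambda> \<parallel>\<xi>\<parallel>\<^sup>2\<close>, so the Cauchy-Schwarz
  inequality in \<open>H\<close> yields \<open>\<parallel>\<xi>\<parallel>\<^sup>2 \<le> \<lambda> \<parallel>\<xi>\<parallel>\<^sub>H\<^sup>2\<close> (lemma \<open>rkhs_l2_embedding\<close>).

  Finally, \<open>\<lambda>\<close> is the largest eigenvalue of \<open>T\<close>. No eigenvalue exceeds it, because an eigenfunction can be
  inserted into the quadratic form. That it is an eigenvalue (lemma \<open>mercer_sup_eigenvalue\<close>) is the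
  variational argument for compact positive operators, where compactness comes from the theorem of
  Arzela and Ascoli. Since \<open>T\<close> maps integrable functions to uniformly continuous ones, the quadratic
  form needs to be studied on uniformly continuous functions only.\<close>

section \<open>Integration over the unit interval\<close>

abbreviation unit_measure :: "real measure" where
  "unit_measure \<equiv> lebesgue_on {0<..<1}"

definition l2_inner :: "(real \<Rightarrow> complex) \<Rightarrow> (real \<Rightarrow> complex) \<Rightarrow> complex" where
  "l2_inner f g = (LINT x | unit_measure. cnj (f x) * g x)"

definition l2_normsq :: "(real \<Rightarrow> complex) \<Rightarrow> real" where
  "l2_normsq f = (LINT x | unit_measure. (cmod (f x))\<^sup>2)"

interpretation unit_measure: finite_measure unit_measure
  by (intro finite_measure_lebesgue_on) simp

lemma measure_unit [simp]: "measure unit_measure {0<..<1} = 1"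
  by (simp add: measure_restrict_space)

lemma integral_unit_const:
  fixes c :: "'a::{banach, second_countable_topology}"
  shows "(LINT x | unit_measure. c) = c"
  by simp

lemma uc_bounded:
  assumes "uniformly_continuous_on {0<..<1::real} (f :: real \<Rightarrow> complex)"
  obtains B where "B > 0" "\<And>x. x \<in> {0<..<1} \<Longrightarrow> cmod (f x) \<le> B"
proof -
  have "bounded (f ` {0<..<1})"
    using bounded_uniformly_continuous_image[OF assms] by simp
  thus ?thesis using that unfolding bounded_pos by blast
qed

lemma uc_mult:
  fixes f g :: "real \<Rightarrow> complex"
  assumes f: "uniformly_continuous_on {0<..<1} f" and g: "uniformly_continuous_on {0<..<1} g"
  shows "uniformly_continuous_on {0<..<1} (\<lambda>x. f x * g x)"
  unfolding uniformly_continuous_on_def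
proof (intro allI impI)
  fix e :: real assume e: "e > 0"
  obtain A where A: "A > 0" "\<And>x. x \<in> {0<..<1} \<Longrightarrow> cmod (f x) \<le> A" using uc_bounded[OF f] by metis
  obtain B where B: "B > 0" "\<And>x. x \<in> {0<..<1} \<Longrightarrow> cmod (g x) \<le> B" using uc_bounded[OF g] by metis
  obtain d1 where d1: "d1 > 0" "\<And>x y. x \<in> {0<..<1} \<Longrightarrow> y \<in> {0<..<1} \<Longrightarrow> dist x y < d1 \<Longrightarrow>
      dist (f x) (f y) < e / (2 * B)"
    using f e B(1) unfolding uniformly_continuous_on_def
    by (metis divide_pos_pos dist_commute mult_pos_pos zero_less_numeral)
  obtain d2 where d2: "d2 > 0" "\<And>x y. x \<in> {0<..<1} \<Longrightarrow> y \<in> {0<..<1} \<Longrightarrow> dist x y < d2 \<Longrightarrow>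
      dist (g x) (g y) < e / (2 * A)"
    using g e A(1) unfolding uniformly_continuous_on_def
    by (metis divide_pos_pos dist_commute mult_pos_pos zero_less_numeral)
  show "\<exists>d>0. \<forall>x\<in>{0<..<1}. \<forall>y\<in>{0<..<1}. dist y x < d \<longrightarrow> dist (f y * g y) (f x * g x) < e"
  proof (intro exI[of _ "min d1 d2"] conjI ballI impI)
    fix x y :: real assume xy: "x \<in> {0<..<1}" "y \<in> {0<..<1}" and d: "dist y x < min d1 d2"
    have "f y * g y - f x * g x = (f y - f x) * g y + f x * (g y - g x)"
      by (simp add: algebra_simps)
    hence "dist (f y * g y) (f x * g x) \<le> cmod (f y - f x) * cmod (g y) + cmod (f x) * cmod (g y - g x)"
      unfolding dist_norm by (metis norm_triangle_ineq norm_mult)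
    also have "\<dots> \<le> cmod (f y - f x) * B + A * cmod (g y - g x)"
      using A B xy by (intro add_mono mult_left_mono mult_right_mono) auto
    also have "\<dots> < e / (2 * B) * B + A * (e / (2 * A))"
      using d1(2)[OF xy(2,1)] d2(2)[OF xy(2,1)] d A B
      by (intro add_strict_mono mult_strict_left_mono mult_strict_right_mono) (auto simp: dist_norm)
    also have "\<dots> = e" using A B by simp
    finally show "dist (f y * g y) (f x * g x) < e" .
  qed (use d1 d2 in auto)
qed

lemma uc_cnj:
  assumes "uniformly_continuous_on S (f :: real \<Rightarrow> complex)"
  shows "uniformly_continuous_on S (\<lambda>x. cnj (f x))"
  using assms unfolding uniformly_continuous_on_def dist_norm
  by (simp add: complex_cnj_diff[symmetric] del: complex_cnj_diff)

lemma uc_measurable: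
  assumes "uniformly_continuous_on {0<..<1::real} (f :: real \<Rightarrow> complex)"
  shows "f \<in> borel_measurable unit_measure"
  using uniformly_continuous_imp_continuous[OF assms]
  by (intro continuous_imp_measurable_on_sets_lebesgue) auto

lemma uc_integrable:
  assumes "uniformly_continuous_on {0<..<1::real} (f :: real \<Rightarrow> complex)"
  shows "integrable unit_measure f"
proof -
  obtain B where "B > 0" "\<And>x. x \<in> {0<..<1} \<Longrightarrow> cmod (f x) \<le> B" using uc_bounded[OF assms] by metis
  thus ?thesis
    by (intro unit_measure.integrable_const_bound[of _ B] uc_measurable assms AE_I2) auto
qed

lemma uc_inner_integrable:
  assumes "uniformly_continuous_on {0<..<1} f" "uniformly_continuous_on {0<..<1} g"
  shows "integrable unit_measure (\<lambda>x. cnj (f x) * g x)"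
  by (intro uc_integrable uc_mult uc_cnj assms)

lemma uc_square_integrable:
  assumes "uniformly_continuous_on {0<..<1} f"
  shows "square_integrable01 f" "integrable unit_measure (\<lambda>x. (cmod (f x))\<^sup>2)"
proof -
  have "integrable unit_measure (\<lambda>x. cmod (cnj (f x) * f x))"
    by (intro integrable_norm uc_inner_integrable assms)
  thus "integrable unit_measure (\<lambda>x. (cmod (f x))\<^sup>2)"
    by (simp add: norm_mult power2_eq_square)
  thus "square_integrable01 f" using uc_measurable[OF assms] by (simp add: square_integrable01_def)
qed

lemma l2_inner_self: "l2_inner f f = of_real (l2_normsq f)"
proof -
  have "l2_inner f f = (LINT x | unit_measure. complex_of_real ((cmod (f x))\<^sup>2))"
    unfolding l2_inner_def
    by (intro Bochner_Integration.integral_cong refl)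
      (simp only: complex_norm_square mult.commute)
  thus ?thesis by (simp only: l2_normsq_def integral_complex_of_real)
qed

lemma l2_normsq_nonneg [simp]: "0 \<le> l2_normsq f"
  by (simp add: l2_normsq_def)

lemma square_integrable01_integrable:
  assumes "square_integrable01 f"
  shows "integrable unit_measure f"
proof (rule Bochner_Integration.integrable_bound)
  show "integrable unit_measure (\<lambda>x. 1 + (cmod (f x))\<^sup>2)"
    using assms by (auto simp: square_integrable01_def)
  show "f \<in> borel_measurable unit_measure" using assms by (simp add: square_integrable01_def)
  have "cmod (f x) \<le> 1 + (cmod (f x))\<^sup>2" for x
    using zero_le_power2[of "cmod (f x) - 1"] norm_ge_zero[of "f x"]
    unfolding power2_diff one_power2 by linarith
  thus "AE x in unit_measure. norm (f x) \<le> norm (1 + (cmod (f x))\<^sup>2)" by simp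
qed

text \<open>The variance of \<open>\<bar>f\<bar>\<close> for the probability measure on \<open>(0,1)\<close> is nonnegative.\<close>

lemma l1_le_l2:
  assumes "square_integrable01 f"
  shows "(LINT x | unit_measure. cmod (f x))\<^sup>2 \<le> l2_normsq f"
proof -
  define m where "m = (LINT x | unit_measure. cmod (f x))"
  have i: "integrable unit_measure (\<lambda>x. cmod (f x))" "integrable unit_measure (\<lambda>x. (cmod (f x))\<^sup>2)"
    using square_integrable01_integrable[OF assms] assms by (auto simp: square_integrable01_def)
  have "0 \<le> (LINT x | unit_measure. (cmod (f x) - m)\<^sup>2)" by simp
  also have "\<dots> = (LINT x | unit_measure. (cmod (f x))\<^sup>2 + m\<^sup>2 - 2 * m * cmod (f x))"
    by (simp add: power2_diff mult.commute mult.left_commute)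
  also have "\<dots> = l2_normsq f + m\<^sup>2 - 2 * m * m"
    using i by (simp add: l2_normsq_def m_def)
  finally show ?thesis by (simp add: m_def power2_eq_square)
qed

subsection \<open>Midpoint sums\<close>

definition midpoints :: "nat \<Rightarrow> real set" where
  "midpoints k = (\<lambda>j. (2 * real j + 1) / (2 * real k)) ` {..<k}"

definition midpoint_sum :: "nat \<Rightarrow> (real \<Rightarrow> complex) \<Rightarrow> complex" where
  "midpoint_sum k f = (\<Sum>x\<in>midpoints k. f x) / of_nat k"

lemma finite_midpoints [simp]: "finite (midpoints k)"
  by (simp add: midpoints_def)

lemma midpoints_subset: "midpoints k \<subseteq> {0<..<1}"
  by (auto simp: midpoints_def field_simps)

lemma inj_midpoint: "inj_on (\<lambda>j. (2 * real j + 1) / (2 * real k)) {..<k}"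
  by (auto simp: inj_on_def)

lemma midpoint_sum_diff:
  "midpoint_sum k (\<lambda>x. f x - g x) = midpoint_sum k f - midpoint_sum k g"
  by (simp add: midpoint_sum_def sum_subtractf diff_divide_distrib)

text \<open>A midpoint sum is an average of values; for \<open>k = 0\<close> it is \<open>0\<close>, which satisfies the bound too.\<close>

lemma norm_midpoint_sum_le:
  assumes "\<And>x. x \<in> {0<..<1} \<Longrightarrow> cmod (f x) \<le> B" and "0 \<le> B"
  shows "cmod (midpoint_sum k f) \<le> B"
proof (cases "k = 0")
  case True
  thus ?thesis using assms by (simp add: midpoint_sum_def)
next
  case False
  have "cmod (\<Sum>x\<in>midpoints k. f x) \<le> of_nat (card (midpoints k)) * B"
    by (intro sum_norm_bound assms(1)) (use midpoints_subset in blast)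
  also have "card (midpoints k) = k"
    using inj_midpoint by (simp add: midpoints_def card_image)
  finally show ?thesis using False by (simp add: midpoint_sum_def norm_divide field_simps)
qed

text \<open>On each of the \<open>k\<close> subintervals the integrand differs from its value at the midpoint by at
  most its oscillation on an interval of length \<open>1/k\<close>.\<close>

lemma midpoint_sum_error:
  fixes f :: "real \<Rightarrow> complex"
  assumes int: "integrable unit_measure f" and k: "k > 0"
    and osc: "\<And>x y. x \<in> {0<..<1} \<Longrightarrow> y \<in> {0<..<1} \<Longrightarrow> \<bar>x - y\<bar> \<le> 1 / real k \<Longrightarrow> cmod (f x - f y) \<le> e"
  shows "cmod (midpoint_sum k f - (LINT x | unit_measure. f x)) \<le> e"
proof -
  define p where "p j = (2 * real j + 1) / (2 * real k)" for j
  have io: "f integrable_on {0<..<1}"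
    using integrable_on_lebesgue_on[OF int] by simp
  hence ic: "f integrable_on {0..1}" by (simp add: integrable_on_open_interval_real)
  have L: "(LINT x | unit_measure. f x) = integral {0..1} f"
    using lebesgue_integral_eq_integral[OF int] by (simp add: integral_open_interval_real)
  have e: "0 \<le> e" using osc[of "1/2" "1/2"] by simp
  have step: "cmod (integral {real j / real k..real (Suc j) / real k} f - f (p j) / of_nat k) \<le> e / real k"
    if j: "j < k" for j
  proof -
    let ?a = "real j / real k" and ?b = "real (Suc j) / real k"
    have ab: "?a \<le> ?b" "0 \<le> ?a" "?b \<le> 1" using j by (auto simp: field_simps)
    have len: "?b - ?a = 1 / real k" by (simp add: add_divide_distrib)
    have p: "?a < p j" "p j < ?b" using k by (auto simp: p_def field_simps)
    have "f integrable_on {?a..?b}"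
      by (rule integrable_subinterval_real[OF ic]) (use ab in auto)
    hence "((\<lambda>x. f x - f (p j)) has_integral (integral {?a..?b} f - (?b - ?a) *\<^sub>R f (p j))) {?a..?b}"
      using ab by (intro has_integral_diff integrable_integral) (use has_integral_const_real[of "f (p j)" ?a ?b] in auto)
    hence "cmod (integral {?a..?b} f - (?b - ?a) *\<^sub>R f (p j)) \<le> e * measure lborel {?a..?b}"
    proof (rule has_integral_bound_real[OF e, of "{0,1}", rotated])
      show "cmod (f x - f (p j)) \<le> e" if "x \<in> {?a..?b} - {0, 1}" for x
      proof (rule osc)
        have x: "?a \<le> x" "x \<le> ?b" "x \<noteq> 0" "x \<noteq> 1" using that by auto
        show "x \<in> {0<..<1}" "p j \<in> {0<..<1}"
          unfolding greaterThanLessThan_iff using x ab p by linarith+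
        show "\<bar>x - p j\<bar> \<le> 1 / real k" using x p len by linarith
      qed
    qed simp
    moreover have "measure lborel {?a..?b} = 1 / real k"
      using ab(1) len by (simp only: measure_lborel_Icc)
    ultimately show ?thesis unfolding len by (simp add: scaleR_conv_of_real)
  qed
  have "integral {0..real n / real k} f = (\<Sum>j<n. integral {real j / real k..real (Suc j) / real k} f)"
    if "n \<le> k" for n
    using that
  proof (induction n)
    case (Suc n)
    have "integral {0..real n / real k} f + integral {real n / real k..real (Suc n) / real k} f
        = integral {0..real (Suc n) / real k} f"
    proof (rule Henstock_Kurzweil_Integration.integral_combine)
      show "f integrable_on {0..real (Suc n) / real k}"
        by (rule integrable_subinterval_real[OF ic]) (use Suc.prems in \<open>auto simp: field_simps\<close>)
    qed (auto simp: divide_right_mono)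
    thus ?case using Suc by simp
  qed simp
  from this[of k] k have
    I: "integral {0..1} f = (\<Sum>j<k. integral {real j / real k..real (Suc j) / real k} f)" by simp
  have S: "midpoint_sum k f = (\<Sum>j<k. f (p j) / of_nat k)"
    unfolding midpoint_sum_def midpoints_def sum.reindex[OF inj_midpoint]
    by (simp add: p_def sum_divide_distrib)
  have "cmod (integral {0..1} f - midpoint_sum k f) \<le> of_nat (card {..<k}) * (e / real k)"
    unfolding I S sum_subtractf[symmetric] using step by (intro sum_norm_bound) auto
  thus ?thesis using k by (simp add: L norm_minus_commute)
qed

section \<open>The kernel of a continuous positive definite function\<close>

abbreviation point :: "real \<Rightarrow> real \<Rightarrow> complex" where
  "point x \<equiv> indicator {x}"

lemma supp_point: "supp (point x) = {x}"
  by (auto simp: supp_def indicator_def)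

lemma point_fin_coeffs: "x \<in> {0<..<1} \<Longrightarrow> point x \<in> fin_coeffs"
  by (simp add: fin_coeffs_def supp_point)

lemma comb_point: "comb F (point x) t = F (t - x)"
  by (simp add: comb_def supp_point)

lemma gram_point: "gram F (point x) c = comb F c x"
  by (simp add: gram_comb supp_point)

locale continuous_positive_definite =
  fixes F :: "real \<Rightarrow> complex"
  assumes cont: "continuous_on {-1<..<1} F" and pd: "positive_definite F"
begin

definition F0 :: real where "F0 = Re (F 0)"

text \<open>This is the distance in the Hilbert space between the kernel sections \<open>F(\<cdot> - x)\<close> and
  \<open>F(\<cdot> - y)\<close>. It serves as a modulus of continuity common to \<open>F\<close>, to the values of the Mercer
  operator and to the elements of the Hilbert space.\<close>

definition kdist :: "real \<Rightarrow> real \<Rightarrow> real" where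
  "kdist x y = gnorm F (point x - point y)"

lemma gram_self:
  assumes "c \<in> fin_coeffs"
  shows "0 \<le> Re (gram F c c)" "gram F c c = of_real (Re (gram F c c))"
  using gram_nonneg[OF pd assms] by (auto simp: complex_nonneg_Reals_iff complex_eq_iff)

lemma F_zero: "F 0 = of_real F0" and F0_nonneg: "0 \<le> F0"
  using gram_self[OF point_fin_coeffs, of "1/2"] by (auto simp: gram_point comb_point F0_def)

lemma gnorm_point: "gnorm F (point x) = sqrt F0"
  by (simp add: gram_point comb_point F0_def)

text \<open>Evaluation at \<open>x\<close> is the inner product with \<open>F(\<cdot> - x)\<close>, whose squared norm is \<open>F(0)\<close>
  whatever the point; hence norm bounds are uniform bounds.\<close>

lemma comb_bound:
  assumes "c \<in> fin_coeffs" "x \<in> {0<..<1}"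
  shows "cmod (comb F c x) \<le> sqrt F0 * gnorm F c"
  using gram_cauchy_schwarz[OF pd point_fin_coeffs[OF assms(2)] assms(1)]
  by (simp only: gram_point gnorm_point) (simp add: gram_point comb_point F0_def)

lemma comb_diff_bound:
  assumes "c \<in> fin_coeffs" "x \<in> {0<..<1}" "y \<in> {0<..<1}"
  shows "cmod (comb F c x - comb F c y) \<le> kdist x y * gnorm F c"
  using gram_cauchy_schwarz[OF pd fin_coeffs_diff[OF point_fin_coeffs[OF assms(2)] point_fin_coeffs[OF assms(3)]] assms(1)]
  by (simp add: gram_diff_left[OF point_fin_coeffs[OF assms(2)] point_fin_coeffs[OF assms(3)]] gram_point kdist_def)

lemma F_cnj:
  assumes "x \<in> {0<..<1}" "y \<in> {0<..<1}"
  shows "F (y - x) = cnj (F (x - y))"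
  using gram_cnj[OF pd point_fin_coeffs[OF assms(1)] point_fin_coeffs[OF assms(2)]]
  by (simp add: gram_point comb_point)

lemma F_bound:
  assumes "x \<in> {0<..<1}" "y \<in> {0<..<1}"
  shows "cmod (F (x - y)) \<le> F0"
  using comb_bound[OF point_fin_coeffs[OF assms(2)] assms(1)] F0_nonneg
  by (simp add: comb_point gram_point F_zero)

lemma kdist_nonneg: "x \<in> {0<..<1} \<Longrightarrow> y \<in> {0<..<1} \<Longrightarrow> 0 \<le> kdist x y"
  unfolding kdist_def by (intro real_sqrt_ge_zero gram_self fin_coeffs_diff point_fin_coeffs)

lemma F_diff_left:
  assumes "x \<in> {0<..<1}" "y \<in> {0<..<1}" "z \<in> {0<..<1}"
  shows "cmod (F (x - z) - F (y - z)) \<le> kdist x y * sqrt F0"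
  using comb_diff_bound[OF point_fin_coeffs[OF assms(3)] assms(1,2)]
  by (simp add: comb_point gram_point F_zero)

lemma F_diff_right:
  assumes "x \<in> {0<..<1}" "y \<in> {0<..<1}" "z \<in> {0<..<1}"
  shows "cmod (F (z - x) - F (z - y)) \<le> kdist x y * sqrt F0"
proof -
  have "F (z - x) - F (z - y) = cnj (F (x - z) - F (y - z))"
    by (simp add: F_cnj[OF assms(1,3)] F_cnj[OF assms(2,3)])
  thus ?thesis using F_diff_left[OF assms] by (simp only: complex_mod_cnj)
qed

lemma kdist_eq:
  assumes "x \<in> {0<..<1}" "y \<in> {0<..<1}"
  shows "kdist x y = sqrt (2 * F0 - 2 * Re (F (x - y)))"
proof -
  have p: "point x \<in> fin_coeffs" "point y \<in> fin_coeffs" using assms point_fin_coeffs by auto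
  have "Re (F (y - x)) = Re (F (x - y))" using F_cnj[OF assms] by simp
  thus ?thesis
    by (simp add: kdist_def gram_diff_left gram_diff_right p gram_point comb_point F_zero)
qed

text \<open>The distance of two kernel sections is a function of \<open>x - y\<close>, so continuity of \<open>F\<close> at \<open>0\<close> makes
  \<open>x \<mapsto> F(\<cdot> - x)\<close> uniformly continuous into the Hilbert space.\<close>

lemma kdist_small:
  assumes "e > 0"
  obtains d where "d > 0"
    "\<And>x y. x \<in> {0<..<1} \<Longrightarrow> y \<in> {0<..<1} \<Longrightarrow> \<bar>x - y\<bar> < d \<Longrightarrow> kdist x y < e"
proof -
  have "isCont F 0" using cont by (simp add: continuous_on_eq_continuous_at)
  hence "(F \<longlongrightarrow> F 0) (at 0)" by (simp add: isCont_def)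
  from tendsto_real_sqrt[OF tendsto_diff[OF tendsto_const tendsto_mult[OF tendsto_const tendsto_Re[OF this]]]]
  have "isCont (\<lambda>t. sqrt (2 * F0 - 2 * Re (F t))) 0" by (simp add: isCont_def)
  from this[unfolded continuous_at_eps_delta, rule_format, OF assms]
  obtain d where d: "d > 0" "\<And>t. \<bar>t\<bar> < d \<Longrightarrow> \<bar>sqrt (2 * F0 - 2 * Re (F t))\<bar> < e"
    by (auto simp: F_zero dist_norm)
  show ?thesis
  proof (rule that[OF d(1)])
    fix x y :: real assume "x \<in> {0<..<1}" "y \<in> {0<..<1}" "\<bar>x - y\<bar> < d"
    thus "kdist x y < e" using d(2)[of "x - y"] by (simp add: kdist_eq)
  qed
qed

lemma kernel_small:
  assumes "e > 0"
  obtains d where "d > 0"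
    "\<forall>x\<in>{0<..<1}. \<forall>y\<in>{0<..<1}. \<forall>z\<in>{0<..<1}. \<bar>x - y\<bar> < d \<longrightarrow>
        cmod (F (x - z) - F (y - z)) < e \<and> cmod (F (z - x) - F (z - y)) < e"
proof -
  have s: "sqrt F0 + 1 > 0" using F0_nonneg by (simp add: add_nonneg_pos)
  have "e / (sqrt F0 + 1) > 0" using assms s by simp
  then obtain d where d: "d > 0" "\<And>x y. x \<in> {0<..<1} \<Longrightarrow> y \<in> {0<..<1} \<Longrightarrow> \<bar>x - y\<bar> < d
      \<Longrightarrow> kdist x y < e / (sqrt F0 + 1)"
    by (rule kdist_small) blast
  show ?thesis
  proof (rule that[OF d(1)], intro ballI impI)
    fix x y z :: real
    assume a: "x \<in> {0<..<1}" "y \<in> {0<..<1}" "z \<in> {0<..<1}" "\<bar>x - y\<bar> < d"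
    have "kdist x y * sqrt F0 \<le> kdist x y * (sqrt F0 + 1)"
      using kdist_nonneg a by (intro mult_left_mono) auto
    also have "\<dots> < e" using d(2)[OF a(1,2,4)] s by (simp add: pos_less_divide_eq)
    finally show "cmod (F (x - z) - F (y - z)) < e \<and> cmod (F (z - x) - F (z - y)) < e"
      using F_diff_left[OF a(1-3)] F_diff_right[OF a(1-3)] by linarith
  qed
qed

text \<open>The points \<open>0\<close>, \<open>s\<close>, \<open>t\<close> span an interval of length less than \<open>1\<close>. Thus two arguments of
  \<open>F\<close> that are close to each other are differences \<open>x - z\<close>, \<open>y - z\<close> of points of \<open>(0,1)\<close> with a
  common \<open>z\<close>, and the Hilbert space estimates apply to them.\<close>

lemma common_translate:
  assumes "s \<in> {-1<..<1::real}" "t \<in> {-1<..<1}" "\<bar>s - t\<bar> < 1"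
  shows "\<exists>z\<in>{0<..<1}. z + s \<in> {0<..<1} \<and> z + t \<in> {0<..<1}"
proof -
  have *: "\<exists>z\<in>{0<..<1}. z + s \<in> {0<..<1} \<and> z + t \<in> {0<..<1}"
    if "-1 < s" "s \<le> t" "t < 1" "t - s < 1" for s t :: real
  proof -
    consider "0 \<le> s" | "t \<le> 0" | "s < 0" "0 < t" by linarith
    thus ?thesis
    proof cases
      case 1 thus ?thesis using that by (intro bexI[of _ "(1 - t) / 2"]) (auto simp: field_simps)
    next
      case 2 thus ?thesis using that by (intro bexI[of _ "(1 - s) / 2"]) (auto simp: field_simps)
    next
      case 3 thus ?thesis using that by (intro bexI[of _ "(1 - s - t) / 2"]) (auto simp: field_simps)
    qed
  qed
  show ?thesis
  proof (cases "s \<le> t")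
    case True thus ?thesis using *[of s t] assms by simp
  next
    case False thus ?thesis using *[of t s] assms by auto
  qed
qed

text \<open>Continuity on an open interval does not control \<open>F\<close> near the end points \<open>-1\<close> and \<open>1\<close>;
  positive definiteness does, since it makes the modulus of continuity at \<open>0\<close> a global one.\<close>

lemma F_uc: "uniformly_continuous_on {-1<..<1} F"
  unfolding uniformly_continuous_on_def
proof (intro allI impI)
  fix e :: real assume "e > 0"
  then obtain d where d: "d > 0" "\<forall>x\<in>{0<..<1}. \<forall>y\<in>{0<..<1}. \<forall>z\<in>{0<..<1}. \<bar>x - y\<bar> < d \<longrightarrow>
        cmod (F (x - z) - F (y - z)) < e \<and> cmod (F (z - x) - F (z - y)) < e"
    by (rule kernel_small)
  show "\<exists>d>0. \<forall>s\<in>{-1<..<1}. \<forall>t\<in>{-1<..<1}. dist t s < d \<longrightarrow> dist (F t) (F s) < e"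
  proof (intro exI[of _ "min d 1"] conjI ballI impI)
    fix s t :: real assume st: "s \<in> {-1<..<1}" "t \<in> {-1<..<1}" and dst: "dist t s < min d 1"
    have "\<bar>s - t\<bar> < 1" using dst by (simp add: dist_real_def abs_minus_commute)
    with st obtain z where z: "z \<in> {0<..<1}" "z + s \<in> {0<..<1}" "z + t \<in> {0<..<1}"
      using common_translate by blast
    have "\<bar>(z + t) - (z + s)\<bar> < d" using dst by (simp add: dist_real_def)
    from d(2)[rule_format, OF z(3,2,1) this] show "dist (F t) (F s) < e" by (simp add: dist_norm)
  next
    show "0 < min d 1" using d(1) by simp
  qed
qed

lemma kernel_uc:
  assumes "x \<in> {0<..<1}"
  shows "uniformly_continuous_on {0<..<1} (\<lambda>y. F (x - y))"
  unfolding uniformly_continuous_on_def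
proof (intro allI impI)
  fix e :: real assume "e > 0"
  then obtain d where d: "d > 0" "\<forall>x\<in>{0<..<1}. \<forall>y\<in>{0<..<1}. \<forall>z\<in>{0<..<1}. \<bar>x - y\<bar> < d \<longrightarrow>
        cmod (F (x - z) - F (y - z)) < e \<and> cmod (F (z - x) - F (z - y)) < e"
    by (rule kernel_small)
  show "\<exists>d>0. \<forall>s\<in>{0<..<1}. \<forall>t\<in>{0<..<1}. dist t s < d \<longrightarrow> dist (F (x - t)) (F (x - s)) < e"
  proof (intro exI[of _ d] conjI ballI impI d(1))
    fix s t :: real assume "s \<in> {0<..<1}" "t \<in> {0<..<1}" "dist t s < d"
    thus "dist (F (x - t)) (F (x - s)) < e"
      using d(2)[rule_format, of t s x] assms by (simp add: dist_norm)
  qed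
qed

section \<open>The Mercer operator on \<open>L\<^sup>2(0,1)\<close>\<close>

lemma kernel_integrable:
  assumes "integrable unit_measure \<phi>" "x \<in> {0<..<1}"
  shows "integrable unit_measure (\<lambda>y. \<phi> y * F (x - y))"
proof (rule Bochner_Integration.integrable_bound)
  show "integrable unit_measure (\<lambda>y. F0 * cmod (\<phi> y))" using assms by auto
  show "(\<lambda>y. \<phi> y * F (x - y)) \<in> borel_measurable unit_measure"
    using uc_measurable[OF kernel_uc[OF assms(2)]] assms(1) by (intro borel_measurable_times) auto
  have "cmod (\<phi> y * F (x - y)) \<le> F0 * cmod (\<phi> y)" if "y \<in> {0<..<1}" for y
    using F_bound[OF assms(2) that] by (simp add: norm_mult mult.commute[of "cmod (\<phi> y)"] mult_right_mono)
  thus "AE y in unit_measure. cmod (\<phi> y * F (x - y)) \<le> norm (F0 * cmod (\<phi> y))"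
    using F0_nonneg by (intro AE_I2) (auto simp: abs_mult)
qed

lemma mercer_eq: "x \<in> {0<..<1} \<Longrightarrow> mercer F \<phi> x = (LINT y | unit_measure. \<phi> y * F (x - y))"
  by (simp add: mercer_def)

lemma mercer_bound:
  assumes "integrable unit_measure \<phi>" "x \<in> {0<..<1}"
  shows "cmod (mercer F \<phi> x) \<le> F0 * (LINT y | unit_measure. cmod (\<phi> y))"
proof -
  have "cmod (mercer F \<phi> x) \<le> (LINT y | unit_measure. F0 * cmod (\<phi> y))"
    unfolding mercer_eq[OF assms(2)]
  proof (rule Bochner_Integration.integral_norm_bound_integral)
    show "cmod (\<phi> y * F (x - y)) \<le> F0 * cmod (\<phi> y)" if "y \<in> space unit_measure" for y
      using F_bound[OF assms(2)] that by (simp add: norm_mult mult.commute[of "cmod (\<phi> y)"] mult_right_mono)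
  qed (use kernel_integrable assms in auto)
  thus ?thesis by simp
qed

text \<open>The modulus of continuity of the kernel passes to \<open>T\<^sub>F \<phi>\<close>, with the \<open>L\<^sup>1\<close> norm of \<open>\<phi>\<close> as a
  factor. Hence the image of every square integrable eigenfunction is uniformly continuous.\<close>

lemma mercer_uc:
  assumes "integrable unit_measure \<phi>"
  shows "uniformly_continuous_on {0<..<1} (mercer F \<phi>)"
  unfolding uniformly_continuous_on_def
proof (intro allI impI)
  fix e :: real assume e: "e > 0"
  define N where "N = (LINT y | unit_measure. cmod (\<phi> y)) + 1"
  have N: "N > 0" by (simp add: N_def add_nonneg_pos)
  have "e / N > 0" using e N by simp
  then obtain d where d: "d > 0" "\<forall>x\<in>{0<..<1}. \<forall>y\<in>{0<..<1}. \<forall>z\<in>{0<..<1}. \<bar>x - y\<bar> < d \<longrightarrow>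
        cmod (F (x - z) - F (y - z)) < e / N \<and> cmod (F (z - x) - F (z - y)) < e / N"
    by (rule kernel_small)
  show "\<exists>d>0. \<forall>s\<in>{0<..<1}. \<forall>t\<in>{0<..<1}. dist t s < d \<longrightarrow> dist (mercer F \<phi> t) (mercer F \<phi> s) < e"
  proof (intro exI[of _ d] conjI ballI impI)
    fix s t :: real assume st: "s \<in> {0<..<1}" "t \<in> {0<..<1}" and dst: "dist t s < d"
    have "mercer F \<phi> t - mercer F \<phi> s = (LINT y | unit_measure. \<phi> y * F (t - y) - \<phi> y * F (s - y))"
      using kernel_integrable assms st by (simp add: mercer_eq)
    also have "cmod \<dots> \<le> (LINT y | unit_measure. e / N * cmod (\<phi> y))"
    proof (rule Bochner_Integration.integral_norm_bound_integral)
      show "cmod (\<phi> y * F (t - y) - \<phi> y * F (s - y)) \<le> e / N * cmod (\<phi> y)"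
        if "y \<in> space unit_measure" for y
      proof -
        have "cmod (\<phi> y) * cmod (F (t - y) - F (s - y)) \<le> cmod (\<phi> y) * (e / N)"
          using d(2)[rule_format, OF st(2,1), of y] dst that by (intro mult_left_mono) (auto simp: dist_real_def)
        thus ?thesis by (simp add: norm_mult[symmetric] right_diff_distrib mult.commute)
      qed
    qed (use kernel_integrable assms st in auto)
    also have "\<dots> = e / N * (N - 1)" by (simp add: N_def)
    also have "\<dots> < e" using e N by (simp add: field_simps)
    finally show "dist (mercer F \<phi> t) (mercer F \<phi> s) < e" by (simp add: dist_norm)
  qed (fact d(1))
qed

lemma mercer_cong_AE:
  assumes "integrable unit_measure \<phi>" "integrable unit_measure \<psi>"
    and "AE x in unit_measure. \<phi> x = \<psi> x"
  shows "mercer F \<phi> = mercer F \<psi>"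
proof
  fix x show "mercer F \<phi> x = mercer F \<psi> x"
  proof (cases "x \<in> {0<..<1}")
    case True
    show ?thesis unfolding mercer_eq[OF True]
      by (rule integral_cong_AE)
        (use kernel_integrable[OF _ True] assms in \<open>auto simp: borel_measurable_integrable\<close>)
  qed (auto simp: mercer_def)
qed

lemma mercer_lin:
  assumes "integrable unit_measure \<phi>" "integrable unit_measure \<psi>"
  shows "mercer F (\<lambda>x. a * \<phi> x + b * \<psi> x) x = a * mercer F \<phi> x + b * mercer F \<psi> x"
proof (cases "x \<in> {0<..<1}")
  case True
  thus ?thesis using kernel_integrable assms by (simp add: mercer_eq distrib_right mult.assoc)
qed (auto simp: mercer_def)

section \<open>The Mercer operator as a map into the reproducing kernel Hilbert space\<close>

text \<open>By the bound on evaluations, a Cauchy sequence for the norm is uniformly Cauchy on \<open>(0,1)\<close>.\<close>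

lemma approximates_uniformly:
  assumes A: "approximates F C \<xi>" and e: "e > 0"
  shows "\<exists>N. \<forall>n\<ge>N. \<forall>t\<in>{0<..<1}. cmod (comb F (C n) t - \<xi> t) \<le> e"
proof -
  have C: "C k \<in> fin_coeffs" for k using A by (simp add: approximates_def)
  have s: "sqrt F0 + 1 > 0" using F0_nonneg by (simp add: add_nonneg_pos)
  have "e / (sqrt F0 + 1) > 0" using e s by simp
  then obtain N where N: "\<forall>m\<ge>N. \<forall>n\<ge>N. gnorm F (C m - C n) < e / (sqrt F0 + 1)"
    using A unfolding approximates_def by blast
  have "cmod (comb F (C n) t - \<xi> t) \<le> e" if n: "n \<ge> N" and t: "t \<in> {0<..<1}" for n t
  proof (rule Lim_bounded)
    show "(\<lambda>m. cmod (comb F (C n) t - comb F (C m) t)) \<longlonglongrightarrow> cmod (comb F (C n) t - \<xi> t)"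
      using A t unfolding approximates_def by (intro tendsto_intros) auto
    show "\<forall>m\<ge>N. cmod (comb F (C n) t - comb F (C m) t) \<le> e"
    proof (intro allI impI)
      fix m assume m: "m \<ge> N"
      have "cmod (comb F (C n) t - comb F (C m) t) \<le> sqrt F0 * gnorm F (C n - C m)"
        using comb_bound[OF fin_coeffs_diff[OF C C] t] by (simp add: comb_diff[OF C C])
      also have "\<dots> \<le> (sqrt F0 + 1) * (e / (sqrt F0 + 1))"
        using N[rule_format, OF n m] F0_nonneg gram_self(1)[OF fin_coeffs_diff[OF C C]] e
        by (intro mult_mono) auto
      also have "\<dots> = e" using s by simp
      finally show "cmod (comb F (C n) t - comb F (C m) t) \<le> e" .
    qed
  qed
  thus ?thesis by blast
qed

text \<open>A combination of kernel sections of norm at most \<open>K\<close> varies between \<open>x\<close> and \<open>y\<close> by at most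
  \<open>K \<cdot> kdist x y\<close>, and this bound survives pointwise limits.\<close>

lemma rkhs_uc:
  assumes "\<xi> \<in> rkhs F"
  shows "uniformly_continuous_on {0<..<1} \<xi>"
  unfolding uniformly_continuous_on_def
proof (intro allI impI)
  fix e :: real assume e: "e > 0"
  obtain C where A: "approximates F C \<xi>" using assms by (auto simp: rkhs_def)
  have C: "C k \<in> fin_coeffs" for k using A by (simp add: approximates_def)
  obtain K where K: "K > 0" "\<And>k. gnorm F (C k) \<le> K" using approximates_bounded[OF pd A] by metis
  have "e / (2 * K) > 0" using e K(1) by simp
  then obtain d where d: "d > 0" "\<And>x y. x \<in> {0<..<1} \<Longrightarrow> y \<in> {0<..<1} \<Longrightarrow> \<bar>x - y\<bar> < d
      \<Longrightarrow> kdist x y < e / (2 * K)"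
    by (rule kdist_small) blast
  show "\<exists>d>0. \<forall>s\<in>{0<..<1}. \<forall>t\<in>{0<..<1}. dist t s < d \<longrightarrow> dist (\<xi> t) (\<xi> s) < e"
  proof (intro exI[of _ d] conjI ballI impI d(1))
    fix s t :: real assume st: "s \<in> {0<..<1}" "t \<in> {0<..<1}" and dst: "dist t s < d"
    have "cmod (\<xi> t - \<xi> s) \<le> e / 2"
    proof (rule Lim_bounded)
      show "(\<lambda>k. cmod (comb F (C k) t - comb F (C k) s)) \<longlonglongrightarrow> cmod (\<xi> t - \<xi> s)"
        using A st unfolding approximates_def by (intro tendsto_intros) auto
      show "\<forall>k\<ge>0. cmod (comb F (C k) t - comb F (C k) s) \<le> e / 2"
      proof (intro allI impI)
        fix k
        have "cmod (comb F (C k) t - comb F (C k) s) \<le> kdist t s * gnorm F (C k)"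
          by (intro comb_diff_bound C st)
        also have "\<dots> \<le> e / (2 * K) * K"
          using d(2)[OF st(2,1)] dst K e gram_self(1)[OF C]
          by (intro mult_mono) (auto simp: dist_real_def)
        also have "\<dots> = e / 2" using K by simp
        finally show "cmod (comb F (C k) t - comb F (C k) s) \<le> e / 2" .
      qed
    qed
    thus "dist (\<xi> t) (\<xi> s) < e" using e by (simp add: dist_norm)
  qed
qed

lemma rkhs_inner_cnj:
  assumes "\<xi> \<in> rkhs F" "\<eta> \<in> rkhs F"
  shows "rkhs_inner F \<eta> \<xi> = cnj (rkhs_inner F \<xi> \<eta>)"
proof -
  obtain C D where A: "approximates F C \<xi>" "approximates F D \<eta>" using assms by (auto simp: rkhs_def)
  hence C: "C k \<in> fin_coeffs" "D k \<in> fin_coeffs" for k by (auto simp: approximates_def)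
  show ?thesis
  proof (rule LIMSEQ_unique)
    show "(\<lambda>k. gram F (D k) (C k)) \<longlonglongrightarrow> rkhs_inner F \<eta> \<xi>" by (intro rkhs_inner_tendsto pd A)
    show "(\<lambda>k. gram F (D k) (C k)) \<longlonglongrightarrow> cnj (rkhs_inner F \<xi> \<eta>)"
      unfolding gram_cnj[OF pd C] by (intro tendsto_cnj rkhs_inner_tendsto pd A)
  qed
qed

lemma rkhs_inner_self:
  assumes "\<xi> \<in> rkhs F"
  shows "rkhs_inner F \<xi> \<xi> = of_real ((rkhs_norm F \<xi>)\<^sup>2)"
proof -
  obtain C where A: "approximates F C \<xi>" using assms by (auto simp: rkhs_def)
  hence C: "C k \<in> fin_coeffs" for k by (auto simp: approximates_def)
  have t: "(\<lambda>k. gram F (C k) (C k)) \<longlonglongrightarrow> rkhs_inner F \<xi> \<xi>" by (intro rkhs_inner_tendsto pd A)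
  have "0 \<le> Re (rkhs_inner F \<xi> \<xi>)"
    by (rule LIMSEQ_le_const[OF tendsto_Re[OF t]]) (use gram_self C in auto)
  moreover have "Im (rkhs_inner F \<xi> \<xi>) = 0"
    using rkhs_inner_cnj[OF assms assms] by (simp add: complex_eq_iff)
  ultimately show ?thesis by (simp add: rkhs_norm_def complex_eq_iff)
qed

lemma rkhs_cauchy_schwarz:
  assumes "\<xi> \<in> rkhs F" "\<eta> \<in> rkhs F"
  shows "cmod (rkhs_inner F \<xi> \<eta>) \<le> rkhs_norm F \<xi> * rkhs_norm F \<eta>"
proof -
  obtain C D where A: "approximates F C \<xi>" "approximates F D \<eta>" using assms by (auto simp: rkhs_def)
  hence C: "C k \<in> fin_coeffs" "D k \<in> fin_coeffs" for k by (auto simp: approximates_def)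
  show ?thesis
  proof (rule LIMSEQ_le)
    show "(\<lambda>k. cmod (gram F (C k) (D k))) \<longlonglongrightarrow> cmod (rkhs_inner F \<xi> \<eta>)"
      by (intro tendsto_norm rkhs_inner_tendsto pd A)
    show "(\<lambda>k. gnorm F (C k) * gnorm F (D k)) \<longlonglongrightarrow> rkhs_norm F \<xi> * rkhs_norm F \<eta>"
      unfolding rkhs_norm_def
      by (intro tendsto_mult tendsto_real_sqrt tendsto_Re rkhs_inner_tendsto pd A)
    show "\<exists>N. \<forall>n\<ge>N. cmod (gram F (C n) (D n)) \<le> gnorm F (C n) * gnorm F (D n)"
      using gram_cauchy_schwarz[OF pd C] by blast
  qed
qed

subsection \<open>Discretization of the Mercer operator\<close>

text \<open>The measure \<open>\<phi>(y) dy\<close> is replaced by point masses at the midpoints, so that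
  \<open>\<integral> \<phi>(y) F(\<cdot> - y) dy\<close> becomes a finite combination of kernel sections.\<close>

definition mercer_coeffs :: "(real \<Rightarrow> complex) \<Rightarrow> nat \<Rightarrow> real \<Rightarrow> complex" where
  "mercer_coeffs \<phi> k x = (if x \<in> midpoints k then \<phi> x / of_nat k else 0)"

lemma supp_mercer_coeffs: "supp (mercer_coeffs \<phi> k) \<subseteq> midpoints k"
  by (auto simp: supp_def mercer_coeffs_def split: if_splits)

lemma mercer_coeffs_fin: "mercer_coeffs \<phi> k \<in> fin_coeffs"
  using supp_mercer_coeffs[of \<phi> k] midpoints_subset[of k] finite_subset[OF _ finite_midpoints[of k]]
  by (auto simp: fin_coeffs_def)

lemma comb_mercer_coeffs:
  "comb F (mercer_coeffs \<phi> k) t = midpoint_sum k (\<lambda>y. \<phi> y * F (t - y))"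
  unfolding comb_eq[OF finite_midpoints supp_mercer_coeffs] midpoint_sum_def sum_divide_distrib
  by (intro sum.cong) (auto simp: mercer_coeffs_def)

lemma gram_mercer_coeffs:
  "gram F (mercer_coeffs \<phi> k) c = midpoint_sum k (\<lambda>x. cnj (\<phi> x) * comb F c x)"
proof -
  have "gram F (mercer_coeffs \<phi> k) c = (\<Sum>x\<in>midpoints k. cnj (mercer_coeffs \<phi> k x) * comb F c x)"
    unfolding gram_comb using supp_mercer_coeffs
    by (intro sum.mono_neutral_left) (auto simp: supp_def)
  thus ?thesis unfolding midpoint_sum_def sum_divide_distrib
    by (simp add: mercer_coeffs_def)
qed

text \<open>The integrands \<open>y \<mapsto> \<phi>(y) F(t - y)\<close> have a modulus of continuity that does not depend
  on \<open>t\<close>, so the midpoint sums converge uniformly in \<open>t\<close>.\<close>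

lemma comb_mercer_uniformly:
  assumes \<phi>: "uniformly_continuous_on {0<..<1} \<phi>" and e: "e > 0"
  shows "\<exists>N. \<forall>n\<ge>N. \<forall>t\<in>{0<..<1}. cmod (comb F (mercer_coeffs \<phi> n) t - mercer F \<phi> t) \<le> e"
proof -
  obtain B where B: "B > 0" "\<And>x. x \<in> {0<..<1} \<Longrightarrow> cmod (\<phi> x) \<le> B" using uc_bounded[OF \<phi>] by metis
  \<comment> \<open>The product \<open>\<phi>(y) F(t - y)\<close> oscillates by at most \<open>e' F(0) + B e'\<close> when both factors
    oscillate by at most \<open>e'\<close>.\<close>
  define e' where "e' = e / (B + F0 + 1)"
  have BF: "B + F0 + 1 > 0" using B F0_nonneg by simp
  have e': "e' > 0" using e BF by (simp add: e'_def)
  obtain d1 where d1: "d1 > 0" "\<forall>x\<in>{0<..<1}. \<forall>y\<in>{0<..<1}. dist y x < d1 \<longrightarrow> dist (\<phi> y) (\<phi> x) < e'"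
    using \<phi> e' unfolding uniformly_continuous_on_def by blast
  from e' obtain d2 where d2: "d2 > 0" "\<forall>x\<in>{0<..<1}. \<forall>y\<in>{0<..<1}. \<forall>z\<in>{0<..<1}. \<bar>x - y\<bar> < d2 \<longrightarrow>
        cmod (F (x - z) - F (y - z)) < e' \<and> cmod (F (z - x) - F (z - y)) < e'"
    by (rule kernel_small)
  obtain N where N: "N > 0" "inverse (real N) < min d1 d2"
    using ex_inverse_of_nat_less[of "min d1 d2"] d1 d2 by auto
  have "cmod (comb F (mercer_coeffs \<phi> n) t - mercer F \<phi> t) \<le> e" if n: "n \<ge> N" and t: "t \<in> {0<..<1}" for n t
    unfolding comb_mercer_coeffs mercer_eq[OF t]
  proof (rule midpoint_sum_error)
    show "integrable unit_measure (\<lambda>y. \<phi> y * F (t - y))"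
      by (intro kernel_integrable uc_integrable \<phi> t)
    show "n > 0" using n N by simp
    fix x y :: real assume xy: "x \<in> {0<..<1}" "y \<in> {0<..<1}" and "\<bar>x - y\<bar> \<le> 1 / real n"
    moreover have "1 / real n \<le> inverse (real N)" using n N by (simp add: field_simps)
    ultimately have l: "\<bar>x - y\<bar> < d1" "\<bar>x - y\<bar> < d2" using N by linarith+
    have "\<phi> x * F (t - x) - \<phi> y * F (t - y)
        = (\<phi> x - \<phi> y) * F (t - x) + \<phi> y * (F (t - x) - F (t - y))"
      by (simp add: algebra_simps)
    also have "cmod \<dots> \<le> cmod (\<phi> x - \<phi> y) * cmod (F (t - x)) + cmod (\<phi> y) * cmod (F (t - x) - F (t - y))"
      by (metis norm_triangle_ineq norm_mult)
    also have "\<dots> \<le> e' * F0 + B * e'"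
    proof (intro add_mono mult_mono)
      show "cmod (\<phi> x - \<phi> y) \<le> e'" using d1(2)[rule_format, OF xy(2,1)] l by (simp add: dist_norm)
      show "cmod (F (t - x) - F (t - y)) \<le> e'" using d2(2)[rule_format, OF xy t] l by simp
    qed (use e' B F_bound t xy in auto)
    also have "\<dots> \<le> e' * (B + F0 + 1)" using e' by (simp add: algebra_simps)
    also have "\<dots> = e" using BF by (simp add: e'_def)
    finally show "cmod (\<phi> x * F (t - x) - \<phi> y * F (t - y)) \<le> e" .
  qed
  thus ?thesis by blast
qed

text \<open>The number \<open>m\<close> of midpoints and the index \<open>n\<close> of the approximation are independent: the
  Cauchy property of the discretizations needs the Gram matrix at arbitrary pairs of large indices.\<close>

lemma midpoint_sum_tendsto_inner:
  assumes \<phi>: "uniformly_continuous_on {0<..<1} \<phi>" and \<eta>: "uniformly_continuous_on {0<..<1} \<eta>"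
    and unif: "\<And>e. e > 0 \<Longrightarrow> \<exists>N. \<forall>n\<ge>N. \<forall>t\<in>{0<..<1}. cmod (g n t - \<eta> t) \<le> e" and e: "e > 0"
  shows "\<exists>N. \<forall>m\<ge>N. \<forall>n\<ge>N. cmod (midpoint_sum m (\<lambda>x. cnj (\<phi> x) * g n x) - l2_inner \<phi> \<eta>) < e"
proof -
  obtain B where B: "B > 0" "\<And>x. x \<in> {0<..<1} \<Longrightarrow> cmod (\<phi> x) \<le> B" using uc_bounded[OF \<phi>] by metis
  define h where "h x = cnj (\<phi> x) * \<eta> x" for x
  have h: "uniformly_continuous_on {0<..<1} h" unfolding h_def by (intro uc_mult uc_cnj \<phi> \<eta>)
  have "e / 3 > 0" using e by simp
  then obtain d where d: "d > 0" "\<forall>x\<in>{0<..<1}. \<forall>y\<in>{0<..<1}. dist y x < d \<longrightarrow> dist (h y) (h x) < e / 3"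
    using h unfolding uniformly_continuous_on_def by blast
  obtain N1 where N1: "N1 > 0" "inverse (real N1) < d"
    using ex_inverse_of_nat_less[of d] d by auto
  have "e / (3 * B) > 0" using e B by simp
  from unif[OF this] obtain N2 where N2: "\<forall>n\<ge>N2. \<forall>t\<in>{0<..<1}. cmod (g n t - \<eta> t) \<le> e / (3 * B)"
    by blast
  have "cmod (midpoint_sum m (\<lambda>x. cnj (\<phi> x) * g n x) - l2_inner \<phi> \<eta>) < e"
    if mn: "m \<ge> max N1 N2" "n \<ge> max N1 N2" for m n
  proof -
    have "cmod (midpoint_sum m (\<lambda>x. cnj (\<phi> x) * g n x - h x)) \<le> e / 3"
    proof (rule norm_midpoint_sum_le)
      fix x :: real assume x: "x \<in> {0<..<1}"
      have "cmod (cnj (\<phi> x) * g n x - h x) = cmod (\<phi> x) * cmod (g n x - \<eta> x)"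
        unfolding h_def right_diff_distrib[symmetric] norm_mult by simp
      also have "\<dots> \<le> B * (e / (3 * B))"
        using B x N2 mn e by (intro mult_mono) auto
      also have "\<dots> = e / 3" using B by simp
      finally show "cmod (cnj (\<phi> x) * g n x - h x) \<le> e / 3" .
    qed (use e in simp)
    moreover have "cmod (midpoint_sum m h - (LINT x | unit_measure. h x)) \<le> e / 3"
    proof (rule midpoint_sum_error)
      show "integrable unit_measure h" by (intro uc_integrable h)
      show "m > 0" using mn N1 by simp
      fix x y :: real assume xy: "x \<in> {0<..<1}" "y \<in> {0<..<1}" and "\<bar>x - y\<bar> \<le> 1 / real m"
      moreover have "1 / real m \<le> inverse (real N1)" using mn N1 by (simp add: field_simps)
      ultimately have "\<bar>x - y\<bar> < d" using N1 by linarith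
      thus "cmod (h x - h y) \<le> e / 3"
        using d(2)[rule_format, OF xy(2,1)] by (simp add: dist_norm)
    qed
    moreover have "l2_inner \<phi> \<eta> = (LINT x | unit_measure. h x)"
      by (simp add: l2_inner_def h_def)
    moreover note norm_triangle_ineq[of "midpoint_sum m (\<lambda>x. cnj (\<phi> x) * g n x) - midpoint_sum m h"
        "midpoint_sum m h - l2_inner \<phi> \<eta>"]
    ultimately show ?thesis using e unfolding midpoint_sum_diff by simp
  qed
  thus ?thesis by blast
qed

text \<open>All inner products of two discretizations of \<open>T\<^sub>F \<phi>\<close> with large indices are close to one and
  the same number \<open>\<langle>\<phi>, T\<^sub>F \<phi>\<rangle>\<close>, so in the expansion of the squared norm of their difference the four
  terms nearly cancel.\<close>

lemma approximates_mercer: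
  assumes \<phi>: "uniformly_continuous_on {0<..<1} \<phi>"
  shows "approximates F (mercer_coeffs \<phi>) (mercer F \<phi>)"
  unfolding approximates_def
proof (intro conjI allI impI ballI mercer_coeffs_fin)
  fix t :: real assume t: "t \<in> {0<..<1}"
  show "(\<lambda>k. comb F (mercer_coeffs \<phi> k) t) \<longlonglongrightarrow> mercer F \<phi> t"
  proof (rule LIMSEQ_I)
    fix r :: real assume "r > 0"
    hence r: "r / 2 > 0" "r / 2 < r" by auto
    from comb_mercer_uniformly[OF \<phi> r(1)] t r(2)
    show "\<exists>no. \<forall>n\<ge>no. norm (comb F (mercer_coeffs \<phi> n) t - mercer F \<phi> t) < r"
      by (meson order.strict_trans1)
  qed
next
  fix e :: real assume e: "e > 0"
  let ?g = "\<lambda>m n. gram F (mercer_coeffs \<phi> m) (mercer_coeffs \<phi> n)"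
  have "e\<^sup>2 / 4 > 0" using e by simp
  from midpoint_sum_tendsto_inner[OF \<phi> mercer_uc[OF uc_integrable[OF \<phi>]] comb_mercer_uniformly[OF \<phi>] this]
  obtain N where N: "\<forall>m\<ge>N. \<forall>n\<ge>N. cmod (?g m n - l2_inner \<phi> (mercer F \<phi>)) < e\<^sup>2 / 4"
    unfolding gram_mercer_coeffs[symmetric] by blast
  have "gnorm F (mercer_coeffs \<phi> m - mercer_coeffs \<phi> n) < e" if mn: "m \<ge> N" "n \<ge> N" for m n
  proof -
    have R: "\<bar>Re (?g i j) - Re (l2_inner \<phi> (mercer F \<phi>))\<bar> < e\<^sup>2 / 4" if "i \<ge> N" "j \<ge> N" for i j
      using N[rule_format, OF that] abs_Re_le_cmod[of "?g i j - l2_inner \<phi> (mercer F \<phi>)"] by simp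
    have "Re (gram F (mercer_coeffs \<phi> m - mercer_coeffs \<phi> n) (mercer_coeffs \<phi> m - mercer_coeffs \<phi> n))
        = Re (?g m m) - Re (?g m n) - Re (?g n m) + Re (?g n n)"
      by (simp add: gram_diff_left gram_diff_right mercer_coeffs_fin)
    also have "\<dots> < e\<^sup>2" using R[OF mn(1,1)] R[OF mn] R[OF mn(2,1)] R[OF mn(2,2)] by linarith
    finally show ?thesis using e by (simp add: real_less_lsqrt)
  qed
  thus "\<exists>N. \<forall>m\<ge>N. \<forall>n\<ge>N. gnorm F (mercer_coeffs \<phi> m - mercer_coeffs \<phi> n) < e" by blast
qed

lemma mercer_in_rkhs:
  assumes "uniformly_continuous_on {0<..<1} \<phi>"
  shows "mercer F \<phi> \<in> rkhs F"
  using approximates_mercer[OF assms] by (auto simp: rkhs_def mercer_def)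

text \<open>This says that \<open>T\<^sub>F\<close> is the adjoint of the inclusion of \<open>H\<^sub>F\<close> into \<open>L\<^sup>2(0,1)\<close>. For the
  discretization of \<open>T\<^sub>F \<phi>\<close> the reproducing property turns the inner product with \<open>\<xi>\<close> into a midpoint
  sum for \<open>\<integral> cnj (\<phi> x) \<xi>(x) dx\<close>. Positivity of \<open>T\<^sub>F\<close> on \<open>L\<^sup>2\<close> is thereby
  inherited from the inner product of \<open>H\<^sub>F\<close>, without an appeal to Fubini's theorem.\<close>

lemma rkhs_inner_mercer:
  assumes \<phi>: "uniformly_continuous_on {0<..<1} \<phi>" and \<xi>: "\<xi> \<in> rkhs F"
  shows "rkhs_inner F (mercer F \<phi>) \<xi> = l2_inner \<phi> \<xi>"
proof -
  obtain D where D: "approximates F D \<xi>" using \<xi> by (auto simp: rkhs_def)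
  have "(\<lambda>k. gram F (mercer_coeffs \<phi> k) (D k)) \<longlonglongrightarrow> l2_inner \<phi> \<xi>"
  proof (rule LIMSEQ_I)
    fix r :: real assume "r > 0"
    from midpoint_sum_tendsto_inner[OF \<phi> rkhs_uc[OF \<xi>] approximates_uniformly[OF D] this]
    show "\<exists>no. \<forall>n\<ge>no. norm (gram F (mercer_coeffs \<phi> n) (D n) - l2_inner \<phi> \<xi>) < r"
      unfolding gram_mercer_coeffs[symmetric] by blast
  qed
  thus ?thesis using rkhs_inner_tendsto[OF pd approximates_mercer[OF \<phi>] D] LIMSEQ_unique by blast
qed

end

section \<open>Bessel's inequality for the Fourier modes\<close>

lemma l2_normsq_eq_0_iff:
  assumes "square_integrable01 f"
  shows "l2_normsq f = 0 \<longleftrightarrow> (AE x in unit_measure. f x = 0)"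
  using integral_nonneg_eq_0_iff_AE[of unit_measure "\<lambda>x. (cmod (f x))\<^sup>2"] assms
  by (simp add: l2_normsq_def square_integrable01_def)

lemma l2_normsq_diff:
  assumes f: "uniformly_continuous_on {0<..<1} f" and g: "uniformly_continuous_on {0<..<1} g"
  shows "l2_normsq (\<lambda>x. f x - a * g x)
    = l2_normsq f - 2 * Re (cnj a * l2_inner g f) + (cmod a)\<^sup>2 * l2_normsq g"
proof -
  have p: "(cmod (u - a * v))\<^sup>2 = (cmod u)\<^sup>2 - 2 * Re (cnj a * (cnj v * u)) + (cmod a)\<^sup>2 * (cmod v)\<^sup>2"
    for u v unfolding cmod_power2 by (simp add: power2_eq_square algebra_simps)
  have i: "integrable unit_measure (\<lambda>x. cnj a * (cnj (g x) * f x))"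
    using uc_inner_integrable[OF g f] by simp
  define R where "R x = Re (cnj a * (cnj (g x) * f x))" for x
  have "integrable unit_measure R" unfolding R_def using i by (rule integrable_Re)
  moreover have "(LINT x | unit_measure. R x) = Re (cnj a * l2_inner g f)"
  proof -
    have "(LINT x | unit_measure. R x) = Re (LINT x | unit_measure. cnj a * (cnj (g x) * f x))"
      unfolding R_def using i by (rule integral_Re)
    also have "(LINT x | unit_measure. cnj a * (cnj (g x) * f x)) = cnj a * l2_inner g f"
      using uc_inner_integrable[OF g f] by (simp add: l2_inner_def)
    finally show ?thesis .
  qed
  ultimately show ?thesis
    unfolding l2_normsq_def p R_def[symmetric]
    using uc_square_integrable(2)[OF f] uc_square_integrable(2)[OF g] by simp
qed

lemma uc_const_mult:
  assumes "uniformly_continuous_on {0<..<1::real} f"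
  shows "uniformly_continuous_on {0<..<1} (\<lambda>x. (a::complex) * f x)"
  by (intro uc_mult uniformly_continuous_on_const assms)

lemma uc_diff_mult:
  assumes "uniformly_continuous_on {0<..<1::real} f" "uniformly_continuous_on {0<..<1} g"
  shows "uniformly_continuous_on {0<..<1} (\<lambda>x. f x - (a::complex) * g x)"
  by (intro uniformly_continuous_on_diff uc_const_mult assms)

lemma fourier_mode_uc: "uniformly_continuous_on {0<..<1} (fourier_mode n)"
proof -
  have "continuous_on {0..1} (fourier_mode n)"
    unfolding fourier_mode_def by (intro continuous_intros)
  hence "uniformly_continuous_on {0..1} (fourier_mode n)"
    by (intro compact_uniformly_continuous) auto
  thus ?thesis unfolding uniformly_continuous_on_def
    by (meson atLeastAtMost_iff greaterThanLessThan_iff less_imp_le)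
qed

lemma integral_fourier_mode:
  "(LINT x | unit_measure. fourier_mode n x) = (if n = 0 then 1 else 0)"
proof (cases "n = 0")
  case True
  thus ?thesis by (simp add: fourier_mode_def integral_unit_const)
next
  case False
  define w where "w = \<i> * of_real (2 * pi * of_int n)"
  have w: "w \<noteq> 0" using False by (simp add: w_def)
  have e: "fourier_mode n = (\<lambda>x. exp (w * of_real x))"
    by (simp add: fun_eq_iff fourier_mode_def w_def mult.assoc)
  have "((\<lambda>x. exp (w * of_real x)) has_integral
      (exp (w * of_real 1) / w - exp (w * of_real 0) / w)) {0..1}"
    by (rule fundamental_theorem_of_calculus)
      (auto intro!: derivative_eq_intros has_vector_derivative_real_field simp: w)
  moreover have "exp w = 1"
    using exp_integer_2pi[of "of_int n"] by (simp add: w_def mult_ac)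
  ultimately have "((fourier_mode n) has_integral 0) {0..1}" by (simp add: e)
  hence "integral {0<..<1} (fourier_mode n) = 0"
    by (simp add: integral_open_interval_real[symmetric] integral_unique)
  thus ?thesis
    using lebesgue_integral_eq_integral[OF uc_integrable[OF fourier_mode_uc]] False by simp
qed

lemma fourier_mode_orthonormal:
  "l2_inner (fourier_mode m) (fourier_mode n) = (if m = n then 1 else 0)"
proof -
  have "cnj (fourier_mode m x) * fourier_mode n x = fourier_mode (n - m) x" for x
    by (simp add: fourier_mode_def exp_cnj exp_add[symmetric] algebra_simps)
  thus ?thesis by (simp add: l2_inner_def integral_fourier_mode)
qed

lemma l2_inner_diff_right:
  assumes "uniformly_continuous_on {0<..<1} e" "uniformly_continuous_on {0<..<1} f"
    "uniformly_continuous_on {0<..<1} g"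
  shows "l2_inner e (\<lambda>x. f x - a * g x) = l2_inner e f - a * l2_inner e g"
proof -
  have "l2_inner e (\<lambda>x. f x - a * g x)
      = (LINT x | unit_measure. cnj (e x) * f x - a * (cnj (e x) * g x))"
    by (simp add: l2_inner_def algebra_simps)
  thus ?thesis using uc_inner_integrable assms by (simp add: l2_inner_def)
qed

text \<open>Subtracting from \<open>\<xi>\<close> its component along one mode lowers the squared norm by the square of that
  coefficient and keeps the coefficients of all other modes.\<close>

lemma bessel_fourier:
  assumes "finite N" "uniformly_continuous_on {0<..<1} \<xi>"
  shows "(\<Sum>n\<in>N. (cmod (l2_inner (fourier_mode n) \<xi>))\<^sup>2) \<le> l2_normsq \<xi>"
  using assms
proof (induction N arbitrary: \<xi> rule: finite_induct)
  case (insert m N)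
  define c where "c = l2_inner (fourier_mode m) \<xi>"
  define \<zeta> where "\<zeta> = (\<lambda>x. \<xi> x - c * fourier_mode m x)"
  have u: "uniformly_continuous_on {0<..<1} \<zeta>"
    unfolding \<zeta>_def by (intro uc_diff_mult fourier_mode_uc insert.prems)
  have 1: "l2_inner (fourier_mode n) \<zeta> = l2_inner (fourier_mode n) \<xi>" if "n \<in> N" for n
    using that insert.hyps unfolding \<zeta>_def
    by (auto simp: l2_inner_diff_right[OF fourier_mode_uc insert.prems fourier_mode_uc]
        fourier_mode_orthonormal)
  have "l2_normsq (fourier_mode m) = 1"
    using fourier_mode_orthonormal[of m m] by (simp add: l2_inner_self)
  hence 2: "l2_normsq \<zeta> = l2_normsq \<xi> - (cmod c)\<^sup>2"
    unfolding \<zeta>_def l2_normsq_diff[OF insert.prems fourier_mode_uc] c_def[symmetric]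
    by (simp add: cmod_power2) (simp add: power2_eq_square)
  have "(\<Sum>n\<in>N. (cmod (l2_inner (fourier_mode n) \<xi>))\<^sup>2)
      = (\<Sum>n\<in>N. (cmod (l2_inner (fourier_mode n) \<zeta>))\<^sup>2)" by (simp add: 1)
  also have "\<dots> \<le> l2_normsq \<xi> - (cmod c)\<^sup>2" using insert.IH[OF u] by (simp add: 2)
  finally show ?case using insert.hyps by (simp add: c_def)
qed simp

context continuous_positive_definite
begin

section \<open>The supremum of the quadratic form\<close>

text \<open>This is the norm of \<open>T\<^sub>F\<close>, as the supremum of its quadratic form over the unit ball. Uniformly
  continuous functions suffice as a domain: \<open>T\<^sub>F\<close> maps into them, so they contain the continuous
  representative of every eigenfunction with nonzero eigenvalue.\<close>

definition mercer_sup :: real where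
  "mercer_sup = (SUP \<phi>\<in>{\<phi>. uniformly_continuous_on {0<..<1} \<phi> \<and> l2_normsq \<phi> \<le> 1}.
     Re (l2_inner \<phi> (mercer F \<phi>)))"

lemma mercer_form_bound:
  assumes \<phi>: "uniformly_continuous_on {0<..<1} \<phi>"
  shows "cmod (l2_inner \<phi> (mercer F \<phi>)) \<le> F0 * l2_normsq \<phi>"
proof -
  define N where "N = (LINT y | unit_measure. cmod (\<phi> y))"
  have i: "integrable unit_measure \<phi>" by (intro uc_integrable \<phi>)
  have "cmod (l2_inner \<phi> (mercer F \<phi>)) \<le> (LINT x | unit_measure. (F0 * N) * cmod (\<phi> x))"
    unfolding l2_inner_def
  proof (rule Bochner_Integration.integral_norm_bound_integral)
    show "integrable unit_measure (\<lambda>x. cnj (\<phi> x) * mercer F \<phi> x)"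
      by (intro uc_inner_integrable mercer_uc \<phi> i)
    show "cmod (cnj (\<phi> x) * mercer F \<phi> x) \<le> (F0 * N) * cmod (\<phi> x)" if "x \<in> space unit_measure" for x
      using mercer_bound[OF i, of x] that
      by (simp add: norm_mult N_def mult.commute[of "cmod (\<phi> x)"] mult_right_mono)
  qed (use i in auto)
  also have "\<dots> = F0 * N\<^sup>2" by (simp add: N_def power2_eq_square)
  also have "\<dots> \<le> F0 * l2_normsq \<phi>"
    using l1_le_l2[OF uc_square_integrable(1)[OF \<phi>]] F0_nonneg by (simp add: N_def mult_left_mono)
  finally show ?thesis .
qed

lemma mercer_form_bdd:
  "bdd_above ((\<lambda>\<phi>. Re (l2_inner \<phi> (mercer F \<phi>)))
     ` {\<phi>. uniformly_continuous_on {0<..<1} \<phi> \<and> l2_normsq \<phi> \<le> 1})"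
proof (rule bdd_aboveI2)
  fix \<phi> assume "\<phi> \<in> {\<phi>. uniformly_continuous_on {0<..<1} \<phi> \<and> l2_normsq \<phi> \<le> 1}"
  hence \<phi>: "uniformly_continuous_on {0<..<1} \<phi>" "l2_normsq \<phi> \<le> 1" by auto
  have "Re (l2_inner \<phi> (mercer F \<phi>)) \<le> F0 * l2_normsq \<phi>"
    using mercer_form_bound[OF \<phi>(1)] complex_Re_le_cmod order_trans by blast
  also have "\<dots> \<le> F0 * 1" using \<phi> F0_nonneg by (intro mult_left_mono) auto
  finally show "Re (l2_inner \<phi> (mercer F \<phi>)) \<le> F0" by simp
qed

lemma mercer_sup_upper:
  assumes "uniformly_continuous_on {0<..<1} \<phi>" "l2_normsq \<phi> \<le> 1"
  shows "Re (l2_inner \<phi> (mercer F \<phi>)) \<le> mercer_sup"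
  unfolding mercer_sup_def by (rule cSUP_upper[OF _ mercer_form_bdd]) (use assms in auto)

lemma mercer_sup_nonneg: "0 \<le> mercer_sup"
  using mercer_sup_upper[OF uniformly_continuous_on_const[of _ 0]]
  by (simp add: l2_inner_def l2_normsq_def)

lemma mercer_form_le:
  assumes \<phi>: "uniformly_continuous_on {0<..<1} \<phi>"
  shows "Re (l2_inner \<phi> (mercer F \<phi>)) \<le> mercer_sup * l2_normsq \<phi>"
proof (cases "l2_normsq \<phi> = 0")
  case True
  thus ?thesis using mercer_form_bound[OF \<phi>] by simp
next
  case False
  define n where "n = l2_normsq \<phi>"
  have n: "n > 0" using False by (simp add: n_def order_less_le)
  define a where "a = complex_of_real (1 / sqrt n)"
  have i: "integrable unit_measure \<phi>" by (intro uc_integrable \<phi>)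
  have a2: "(cmod a)\<^sup>2 = 1 / n" "cnj a * a = of_real (1 / n)"
    using n by (simp_all add: a_def norm_divide power_divide flip: of_real_mult)
  have m: "mercer F (\<lambda>x. a * \<phi> x) = (\<lambda>x. a * mercer F \<phi> x)"
    using mercer_lin[OF i i, of a 0] by auto
  have "l2_normsq (\<lambda>x. a * \<phi> x) = (cmod a)\<^sup>2 * n"
    by (simp add: l2_normsq_def n_def norm_mult power_mult_distrib)
  also have "\<dots> = 1" using n a2 by simp
  finally have 1: "l2_normsq (\<lambda>x. a * \<phi> x) = 1" .
  have "l2_inner (\<lambda>x. a * \<phi> x) (\<lambda>x. a * mercer F \<phi> x)
      = (LINT x | unit_measure. (cnj a * a) * (cnj (\<phi> x) * mercer F \<phi> x))"
    by (simp add: l2_inner_def mult_ac)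
  also have "\<dots> = of_real (1 / n) * l2_inner \<phi> (mercer F \<phi>)"
    unfolding a2 l2_inner_def by simp
  finally have "Re (l2_inner \<phi> (mercer F \<phi>)) / n \<le> mercer_sup"
    using mercer_sup_upper[OF uc_const_mult[OF \<phi>], of a] 1 by (simp add: m)
  thus ?thesis using n by (simp add: n_def pos_divide_le_eq)
qed

text \<open>Positivity of the Mercer operator: \<open>\<langle>\<phi>, T\<^sub>F \<phi>\<rangle>\<close> is the squared norm of \<open>T\<^sub>F \<phi>\<close> in the
  Hilbert space.\<close>

lemma mercer_form_eq:
  assumes \<phi>: "uniformly_continuous_on {0<..<1} \<phi>"
  shows "l2_inner \<phi> (mercer F \<phi>) = of_real ((rkhs_norm F (mercer F \<phi>))\<^sup>2)"
  using rkhs_inner_mercer[OF \<phi> mercer_in_rkhs[OF \<phi>]] rkhs_inner_self[OF mercer_in_rkhs[OF \<phi>]]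
  by simp

text \<open>The inclusion into \<open>L\<^sup>2(0,1)\<close> and its adjoint have the same norm, and the squared norm of the
  adjoint is the supremum of \<open>\<langle>\<phi>, T\<^sub>F \<phi>\<rangle>\<close>. Concretely, the squared \<open>L\<^sup>2\<close> norm of \<open>\<xi>\<close> is the inner product
  of \<open>T\<^sub>F \<xi>\<close> and \<open>\<xi>\<close> in the Hilbert space, to which Cauchy-Schwarz applies.\<close>

lemma rkhs_l2_embedding:
  assumes \<xi>: "\<xi> \<in> rkhs F"
  shows "l2_normsq \<xi> \<le> mercer_sup * (rkhs_norm F \<xi>)\<^sup>2"
proof (cases "l2_normsq \<xi> = 0")
  case True
  thus ?thesis using mercer_sup_nonneg by simp
next
  case False
  define n where "n = l2_normsq \<xi>"
  have n: "n > 0" using False by (simp add: n_def order_less_le)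
  have u: "uniformly_continuous_on {0<..<1} \<xi>" by (rule rkhs_uc[OF \<xi>])
  have "n = cmod (rkhs_inner F (mercer F \<xi>) \<xi>)"
    using n by (simp add: rkhs_inner_mercer[OF u \<xi>] l2_inner_self n_def)
  also have "\<dots> \<le> rkhs_norm F (mercer F \<xi>) * rkhs_norm F \<xi>"
    by (intro rkhs_cauchy_schwarz mercer_in_rkhs u \<xi>)
  finally have "n\<^sup>2 \<le> (rkhs_norm F (mercer F \<xi>) * rkhs_norm F \<xi>)\<^sup>2"
    using n by (intro power_mono) auto
  also have "\<dots> = Re (l2_inner \<xi> (mercer F \<xi>)) * (rkhs_norm F \<xi>)\<^sup>2"
    by (simp add: mercer_form_eq[OF u] power_mult_distrib)
  also have "\<dots> \<le> (mercer_sup * n) * (rkhs_norm F \<xi>)\<^sup>2"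
    unfolding n_def by (intro mult_right_mono mercer_form_le u) auto
  finally have "n * n \<le> n * (mercer_sup * (rkhs_norm F \<xi>)\<^sup>2)"
    by (simp add: power2_eq_square mult_ac)
  thus ?thesis using n by (simp add: n_def)
qed

text \<open>The operator inequality \<open>T\<^sup>2 \<le> \<lambda> T\<close> for a positive operator of norm \<open>\<lambda>\<close>, obtained by putting
  \<open>\<xi> = T\<^sub>F \<phi>\<close> into the embedding estimate.\<close>

lemma mercer_l2_le_form:
  assumes \<phi>: "uniformly_continuous_on {0<..<1} \<phi>"
  shows "l2_normsq (mercer F \<phi>) \<le> mercer_sup * Re (l2_inner \<phi> (mercer F \<phi>))"
  using rkhs_l2_embedding[OF mercer_in_rkhs[OF \<phi>]] by (simp add: mercer_form_eq[OF \<phi>])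

text \<open>Expanding the square and using \<open>T\<^sup>2 \<le> \<lambda> T\<close> shows that near-maximizers of the quadratic form
  are approximate eigenvectors.\<close>

lemma mercer_near_eigenfunction:
  assumes \<phi>: "uniformly_continuous_on {0<..<1} \<phi>" and n: "l2_normsq \<phi> \<le> 1"
  shows "l2_normsq (\<lambda>x. mercer F \<phi> x - of_real mercer_sup * \<phi> x)
    \<le> mercer_sup * (mercer_sup - Re (l2_inner \<phi> (mercer F \<phi>)))"
proof -
  have m: "uniformly_continuous_on {0<..<1} (mercer F \<phi>)" by (intro mercer_uc uc_integrable \<phi>)
  have "mercer_sup\<^sup>2 * l2_normsq \<phi> \<le> mercer_sup\<^sup>2 * 1" using n by (intro mult_left_mono) auto
  thus ?thesis
    using mercer_l2_le_form[OF \<phi>] unfolding l2_normsq_diff[OF m \<phi>]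
    by (simp add: algebra_simps power2_eq_square)
qed

text \<open>An eigenfunction for \<open>\<mu> \<noteq> 0\<close> agrees almost everywhere with \<open>T\<^sub>F \<phi> / \<mu>\<close>, which is uniformly
  continuous and can be tested in the quadratic form.\<close>

lemma mercer_eigenvalue_le_sup:
  assumes "mercer_eigenvalue F \<mu>"
  shows "Re \<mu> \<le> mercer_sup"
proof (cases "\<mu> = 0")
  case True
  thus ?thesis using mercer_sup_nonneg by simp
next
  case False
  obtain \<phi> where sq: "square_integrable01 \<phi>" and nz: "\<not> (AE x in unit_measure. \<phi> x = 0)"
    and eig: "AE x in unit_measure. mercer F \<phi> x = \<mu> * \<phi> x"
    using assms by (auto simp: mercer_eigenvalue_def)
  have i: "integrable unit_measure \<phi>" by (rule square_integrable01_integrable[OF sq])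
  define \<psi> where "\<psi> = (\<lambda>x. inverse \<mu> * mercer F \<phi> x)"
  have u: "uniformly_continuous_on {0<..<1} \<psi>"
    unfolding \<psi>_def by (intro uc_const_mult mercer_uc i)
  have ae: "AE x in unit_measure. \<phi> x = \<psi> x"
    using eig by eventually_elim (simp add: \<psi>_def False)
  have "mercer F \<psi> = mercer F \<phi>"
    by (rule mercer_cong_AE[OF i uc_integrable[OF u] ae, symmetric])
  hence m: "mercer F \<psi> = (\<lambda>x. \<mu> * \<psi> x)"
    using False by (simp add: \<psi>_def fun_eq_iff mult.assoc[symmetric])
  have "l2_inner \<psi> (mercer F \<psi>) = (LINT x | unit_measure. \<mu> * (cnj (\<psi> x) * \<psi> x))"
    by (simp add: l2_inner_def m mult_ac)
  also have "\<dots> = \<mu> * of_real (l2_normsq \<psi>)"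
    using l2_inner_self[of \<psi>] by (simp add: l2_inner_def)
  finally have le: "Re \<mu> * l2_normsq \<psi> \<le> mercer_sup * l2_normsq \<psi>"
    using mercer_form_le[OF u] by simp
  have "l2_normsq \<psi> \<noteq> 0"
  proof
    assume "l2_normsq \<psi> = 0"
    hence "AE x in unit_measure. \<psi> x = 0"
      using l2_normsq_eq_0_iff[OF uc_square_integrable(1)[OF u]] by simp
    with ae have "AE x in unit_measure. \<phi> x = 0" by eventually_elim simp
    with nz show False by blast
  qed
  hence "l2_normsq \<psi> > 0" by (simp add: order_less_le)
  with le show ?thesis by simp
qed

section \<open>The largest eigenvalue\<close>

text \<open>Compactness of \<open>T\<^sub>F\<close>, by the theorem of Arzela and Ascoli. That theorem needs a compact domain,
  so the uniformly continuous \<open>F\<close> is first extended to \<open>G\<close> on \<open>[-1,1]\<close>; the functions \<open>h n\<close> are then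
  defined and equicontinuous on all of \<open>[0,1]\<close>.\<close>

lemma mercer_precompact:
  assumes \<phi>: "\<And>n. uniformly_continuous_on {0<..<1} (\<phi> n)" "\<And>n. l2_normsq (\<phi> n) \<le> 1"
  obtains \<psi> k where "uniformly_continuous_on {0<..<1} \<psi>" "strict_mono (k :: nat \<Rightarrow> nat)"
    "\<And>e. e > 0 \<Longrightarrow> \<exists>N. \<forall>n\<ge>N. \<forall>x\<in>{0<..<1}. cmod (mercer F (\<phi> (k n)) x - \<psi> x) < e"
proof -
  obtain G where G: "uniformly_continuous_on (closure {-1<..<1}) G" "\<And>x. x \<in> {-1<..<1} \<Longrightarrow> F x = G x"
    using uniformly_continuous_on_extension_on_closure[OF F_uc] by metis
  hence G1: "uniformly_continuous_on {-1..1} G" by simp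
  have "bounded (G ` {-1..1})" using bounded_uniformly_continuous_image[OF G1] by simp
  then obtain M where M: "M > 0" "\<And>x. x \<in> {-1..1} \<Longrightarrow> cmod (G x) \<le> M"
    unfolding bounded_pos by blast
  define h where "h n x = (LINT y | unit_measure. \<phi> n y * G (x - y))" for n x
  have h_mercer: "mercer F (\<phi> n) x = h n x" if "x \<in> {0<..<1}" for n x
    unfolding h_def mercer_eq[OF that]
    by (rule Bochner_Integration.integral_cong[OF refl]) (use that G(2) in auto)
  have int\<phi>: "integrable unit_measure (\<phi> n)" for n by (intro uc_integrable \<phi>)
  have l1: "(LINT y | unit_measure. cmod (\<phi> n y)) \<le> 1" for n
  proof -
    have "(LINT y | unit_measure. cmod (\<phi> n y))\<^sup>2 \<le> 1"
      using l1_le_l2[OF uc_square_integrable(1)[OF \<phi>(1)]] \<phi>(2) order_trans by blast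
    thus ?thesis by (simp add: power_le_one_iff)
  qed
  have intG: "integrable unit_measure (\<lambda>y. \<phi> n y * G (x - y))" if x: "x \<in> {0..1}" for n x
  proof (intro uc_integrable uc_mult \<phi>)
    show "uniformly_continuous_on {0<..<1} (\<lambda>y. G (x - y))"
      unfolding uniformly_continuous_on_def
    proof (intro allI impI)
      fix e :: real assume "e > 0"
      then obtain d where d: "d > 0" "\<forall>s\<in>{-1..1}. \<forall>t\<in>{-1..1}. dist t s < d \<longrightarrow> dist (G t) (G s) < e"
        using G1 unfolding uniformly_continuous_on_def by blast
      show "\<exists>d>0. \<forall>s\<in>{0<..<1}. \<forall>t\<in>{0<..<1}. dist t s < d \<longrightarrow> dist (G (x - t)) (G (x - s)) < e"
      proof (intro exI[of _ d] conjI ballI impI d(1))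
        fix s t :: real assume "s \<in> {0<..<1}" "t \<in> {0<..<1}" "dist t s < d"
        thus "dist (G (x - t)) (G (x - s)) < e"
          using d(2)[rule_format, of "x - s" "x - t"] x by (simp add: dist_real_def abs_minus_commute)
      qed
    qed
  qed
  have osc: "cmod (LINT y | unit_measure. \<phi> n y * f y) \<le> e"
    if "integrable unit_measure (\<lambda>y. \<phi> n y * f y)" "\<And>y. y \<in> {0<..<1} \<Longrightarrow> cmod (f y) \<le> e" "e \<ge> 0" for n f e
  proof -
    have "cmod (LINT y | unit_measure. \<phi> n y * f y) \<le> (LINT y | unit_measure. e * cmod (\<phi> n y))"
    proof (rule Bochner_Integration.integral_norm_bound_integral[OF that(1)])
      show "cmod (\<phi> n y * f y) \<le> e * cmod (\<phi> n y)" if "y \<in> space unit_measure" for y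
        using \<open>\<And>y. y \<in> {0<..<1} \<Longrightarrow> cmod (f y) \<le> e\<close>[of y] that
        by (simp add: norm_mult mult.commute[of "cmod (\<phi> n y)"] mult_right_mono)
    qed (use int\<phi> in auto)
    also have "\<dots> = e * (LINT y | unit_measure. cmod (\<phi> n y))" by simp
    also have "\<dots> \<le> e * 1" using l1 that by (intro mult_left_mono) auto
    finally show ?thesis by simp
  qed
  obtain \<psi> k where \<psi>: "continuous_on {0..1} \<psi>" and k: "strict_mono (k :: nat \<Rightarrow> nat)"
    and conv: "\<And>e. e > 0 \<Longrightarrow> \<exists>N. \<forall>n x. n \<ge> N \<and> x \<in> {0..1} \<longrightarrow> cmod (h (k n) x - \<psi> x) < e"
  proof (rule Arzela_Ascoli[of "{0..1::real}" h M])
    show "cmod (h n x) \<le> M" if "x \<in> {0..1}" for n x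
      unfolding h_def by (rule osc[OF intG[OF that]]) (use M that in auto)
    show "\<exists>d>0. \<forall>n y. y \<in> {0..1} \<and> norm (x - y) < d \<longrightarrow> cmod (h n x - h n y) < e"
      if x: "x \<in> {0..1}" and e: "e > 0" for x e
    proof -
      have "e / 2 > 0" using e by simp
      then obtain d where d: "d > 0" "\<forall>s\<in>{-1..1}. \<forall>t\<in>{-1..1}. dist t s < d \<longrightarrow> dist (G t) (G s) < e / 2"
        using G1 unfolding uniformly_continuous_on_def by blast
      have "cmod (h n x - h n y) < e" if y: "y \<in> {0..1}" "norm (x - y) < d" for n y
      proof -
        have "h n x - h n y = (LINT z | unit_measure. \<phi> n z * (G (x - z) - G (y - z)))"
          using intG[OF x, of n] intG[OF y(1), of n] by (simp add: h_def right_diff_distrib)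
        also have "cmod \<dots> \<le> e / 2"
        proof (rule osc)
          show "integrable unit_measure (\<lambda>z. \<phi> n z * (G (x - z) - G (y - z)))"
            using intG[OF x, of n] intG[OF y(1), of n] by (simp add: right_diff_distrib)
          show "cmod (G (x - z) - G (y - z)) \<le> e / 2" if "z \<in> {0<..<1}" for z
            using d(2)[rule_format, of "y - z" "x - z"] x y that by (simp add: dist_norm)
        qed (use e in simp)
        finally show ?thesis using e by simp
      qed
      thus ?thesis using d(1) by blast
    qed
  qed auto
  show ?thesis
  proof (rule that[OF _ k])
    have "uniformly_continuous_on {0..1} \<psi>" by (intro compact_uniformly_continuous \<psi>) auto
    thus "uniformly_continuous_on {0<..<1} \<psi>" unfolding uniformly_continuous_on_def
      by (meson atLeastAtMost_iff greaterThanLessThan_iff less_imp_le)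
    fix e :: real assume "e > 0"
    from conv[OF this] obtain N where "\<forall>n x. n \<ge> N \<and> x \<in> {0..1} \<longrightarrow> cmod (h (k n) x - \<psi> x) < e" ..
    thus "\<exists>N. \<forall>n\<ge>N. \<forall>x\<in>{0<..<1}. cmod (mercer F (\<phi> (k n)) x - \<psi> x) < e"
      by (intro exI[of _ N]) (auto simp: h_mercer)
  qed
qed

text \<open>If the supremum \<open>\<lambda>\<close> is positive, take a maximizing sequence \<open>\<phi>\<^sub>n\<close>. Along a subsequence
  \<open>T\<^sub>F \<phi>\<^sub>n\<close> converges uniformly to some \<open>\<psi>\<close>, and since \<open>T\<^sub>F \<phi>\<^sub>n - \<lambda> \<phi>\<^sub>n\<close> tends to \<open>0\<close> in \<open>L\<^sup>2\<close>, so does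
  \<open>\<psi> - \<lambda> \<phi>\<^sub>n\<close>. Applying \<open>T\<^sub>F\<close> to the latter gives \<open>T\<^sub>F \<psi> = \<lambda> \<psi>\<close>. If the supremum is \<open>0\<close>, the inequality
  \<open>T\<^sup>2 \<le> \<lambda> T\<close> makes \<open>T\<^sub>F\<close> vanish, and the constant \<open>1\<close> is an eigenfunction for \<open>0\<close>.\<close>

lemma mercer_sup_eigenvalue: "mercer_eigenvalue F (of_real mercer_sup)"
proof (cases "mercer_sup = 0")
  case True
  have u: "uniformly_continuous_on {0<..<1} (\<lambda>_::real. 1::complex)" by (rule uniformly_continuous_on_const)
  have m: "uniformly_continuous_on {0<..<1} (mercer F (\<lambda>_. 1))" by (intro mercer_uc uc_integrable u)
  have "l2_normsq (mercer F (\<lambda>_. 1)) = 0"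
    using mercer_l2_le_form[OF u] True l2_normsq_nonneg[of "mercer F (\<lambda>_. 1)"] by simp
  hence "AE x in unit_measure. mercer F (\<lambda>_. 1) x = 0"
    using l2_normsq_eq_0_iff[OF uc_square_integrable(1)[OF m]] by simp
  moreover have "\<not> (AE x in unit_measure. (1::complex) = 0)"
    using l2_normsq_eq_0_iff[OF uc_square_integrable(1)[OF u]]
    by (simp add: l2_normsq_def integral_unit_const)
  ultimately show ?thesis
    unfolding mercer_eigenvalue_def using uc_square_integrable(1)[OF u] True
    by (intro exI[of _ "\<lambda>_. 1"]) simp
next
  case False
  hence pos: "mercer_sup > 0" using mercer_sup_nonneg by simp
  let ?q = "\<lambda>\<phi>. Re (l2_inner \<phi> (mercer F \<phi>))" and ?l = "complex_of_real mercer_sup"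
  have "\<exists>\<phi>. uniformly_continuous_on {0<..<1} \<phi> \<and> l2_normsq \<phi> \<le> 1 \<and> mercer_sup - inverse (real (Suc n)) < ?q \<phi>" for n
  proof -
    have "(\<lambda>_. 0) \<in> {\<phi>. uniformly_continuous_on {0<..<1} \<phi> \<and> l2_normsq \<phi> \<le> 1}"
      by (auto simp: l2_normsq_def intro: uniformly_continuous_on_const)
    hence ne: "{\<phi>. uniformly_continuous_on {0<..<1} \<phi> \<and> l2_normsq \<phi> \<le> 1} \<noteq> {}" by blast
    have "mercer_sup - inverse (real (Suc n)) < mercer_sup" by simp
    thus ?thesis unfolding mercer_sup_def using less_cSUP_iff[OF ne mercer_form_bdd] by blast
  qed
  then obtain \<phi> where \<phi>: "\<And>n. uniformly_continuous_on {0<..<1} (\<phi> n)" "\<And>n. l2_normsq (\<phi> n) \<le> 1"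
    and q: "\<And>n. mercer_sup - inverse (real (Suc n)) < ?q (\<phi> n)" by metis
  obtain \<psi> k where \<psi>: "uniformly_continuous_on {0<..<1} \<psi>" and k: "strict_mono (k :: nat \<Rightarrow> nat)"
    and conv: "\<And>e. e > 0 \<Longrightarrow> \<exists>N. \<forall>n\<ge>N. \<forall>x\<in>{0<..<1}. cmod (mercer F (\<phi> (k n)) x - \<psi> x) < e"
    by (rule mercer_precompact[of \<phi>, OF \<phi>]) blast
  have m: "uniformly_continuous_on {0<..<1} (mercer F (\<phi> n))" for n
    by (intro mercer_uc uc_integrable \<phi>)
  have Suck: "(\<lambda>n. inverse (real (Suc (k n)))) \<longlonglongrightarrow> 0"
    using LIMSEQ_subseq_LIMSEQ[OF LIMSEQ_inverse_real_of_nat k] by (simp add: o_def)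
  define a where "a n = l2_normsq (\<lambda>x. \<psi> x - mercer F (\<phi> (k n)) x)" for n
  have a: "a \<longlonglongrightarrow> 0"
  proof (rule LIMSEQ_I)
    fix r :: real assume r: "r > 0"
    have "sqrt (r / 2) > 0" using r by simp
    from conv[OF this] obtain N where
      N: "\<forall>n\<ge>N. \<forall>x\<in>{0<..<1}. cmod (mercer F (\<phi> (k n)) x - \<psi> x) < sqrt (r / 2)" by blast
    have "norm (a n - 0) < r" if n: "n \<ge> N" for n
    proof -
      have "a n \<le> (LINT x | unit_measure. r / 2)"
        unfolding a_def l2_normsq_def
      proof (rule Bochner_Integration.integral_mono)
        show "integrable unit_measure (\<lambda>x. (cmod (\<psi> x - mercer F (\<phi> (k n)) x))\<^sup>2)"
          by (intro uc_square_integrable uniformly_continuous_on_diff \<psi> m)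
        fix x assume "x \<in> space unit_measure"
        hence "cmod (mercer F (\<phi> (k n)) x - \<psi> x) < sqrt (r / 2)" using N n by simp
        hence "(cmod (mercer F (\<phi> (k n)) x - \<psi> x))\<^sup>2 \<le> (sqrt (r / 2))\<^sup>2" by (intro power_mono) auto
        thus "(cmod (\<psi> x - mercer F (\<phi> (k n)) x))\<^sup>2 \<le> r / 2" using r by (simp add: norm_minus_commute)
      qed simp
      also have "\<dots> < r" using r by (simp add: integral_unit_const)
      finally show ?thesis by (simp add: a_def)
    qed
    thus "\<exists>N. \<forall>n\<ge>N. norm (a n - 0) < r" by blast
  qed
  define b where "b n = l2_normsq (\<lambda>x. \<psi> x - ?l * \<phi> (k n) x)" for n
  have ub: "uniformly_continuous_on {0<..<1} (\<lambda>x. \<psi> x - ?l * \<phi> (k n) x)" for n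
    by (intro uc_diff_mult \<psi> \<phi>)
  have "b n \<le> 2 * a n + 2 * (mercer_sup * inverse (real (Suc (k n))))" for n
  proof -
    let ?u = "\<lambda>x. \<psi> x - mercer F (\<phi> (k n)) x" and ?v = "\<lambda>x. mercer F (\<phi> (k n)) x - ?l * \<phi> (k n) x"
    have iu: "integrable unit_measure (\<lambda>x. (cmod (?u x))\<^sup>2)"
      by (intro uc_square_integrable uniformly_continuous_on_diff \<psi> m)
    have iv: "integrable unit_measure (\<lambda>x. (cmod (?v x))\<^sup>2)"
      by (intro uc_square_integrable uc_diff_mult \<phi> m)
    have "b n \<le> (LINT x | unit_measure. 2 * (cmod (?u x))\<^sup>2 + 2 * (cmod (?v x))\<^sup>2)"
      unfolding b_def l2_normsq_def
    proof (rule Bochner_Integration.integral_mono)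
      show "integrable unit_measure (\<lambda>x. (cmod (\<psi> x - ?l * \<phi> (k n) x))\<^sup>2)"
        by (intro uc_square_integrable ub)
      fix x
      have "(cmod (z + w))\<^sup>2 \<le> 2 * (cmod z)\<^sup>2 + 2 * (cmod w)\<^sup>2" for z w
      proof -
        have "(cmod (z + w))\<^sup>2 \<le> (cmod z + cmod w)\<^sup>2" by (intro power_mono norm_triangle_ineq) simp
        also have "\<dots> \<le> 2 * (cmod z)\<^sup>2 + 2 * (cmod w)\<^sup>2"
          using zero_le_power2[of "cmod z - cmod w"] unfolding power2_sum power2_diff by linarith
        finally show ?thesis .
      qed
      from this[of "?u x" "?v x"]
      show "(cmod (\<psi> x - ?l * \<phi> (k n) x))\<^sup>2 \<le> 2 * (cmod (?u x))\<^sup>2 + 2 * (cmod (?v x))\<^sup>2" by simp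
    qed (use iu iv in auto)
    also have "\<dots> = 2 * a n + 2 * l2_normsq ?v" using iu iv by (simp add: a_def l2_normsq_def)
    also have "l2_normsq ?v \<le> mercer_sup * (mercer_sup - ?q (\<phi> (k n)))"
      by (intro mercer_near_eigenfunction \<phi>)
    also have "\<dots> \<le> mercer_sup * inverse (real (Suc (k n)))"
      using q[of "k n"] pos by (intro mult_left_mono) auto
    finally show ?thesis by simp
  qed
  moreover have "(\<lambda>n. 2 * a n + 2 * (mercer_sup * inverse (real (Suc (k n))))) \<longlonglongrightarrow> 0"
    using tendsto_add[OF tendsto_mult_left[OF a, of 2] tendsto_mult_left[OF Suck, of "2 * mercer_sup"]]
    by (simp add: mult.assoc)
  ultimately have b: "b \<longlonglongrightarrow> 0"
    by (intro tendsto_sandwich[OF _ _ tendsto_const, of 0 b]) (auto simp: b_def)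
  have eig: "mercer F \<psi> x = ?l * \<psi> x" if x: "x \<in> {0<..<1}" for x
  proof -
    have "(\<lambda>n. mercer F (\<lambda>x. \<psi> x - ?l * \<phi> (k n) x) x) \<longlonglongrightarrow> 0"
    proof (rule Lim_null_comparison)
      show "\<forall>\<^sub>F n in sequentially. norm (mercer F (\<lambda>x. \<psi> x - ?l * \<phi> (k n) x) x) \<le> F0 * sqrt (b n)"
      proof (intro always_eventually allI)
        fix n
        have "norm (mercer F (\<lambda>x. \<psi> x - ?l * \<phi> (k n) x) x)
            \<le> F0 * (LINT y | unit_measure. cmod (\<psi> y - ?l * \<phi> (k n) y))"
          by (intro mercer_bound uc_integrable ub x)
        also have "\<dots> \<le> F0 * sqrt (b n)"
          using l1_le_l2[OF uc_square_integrable(1)[OF ub, of n]] F0_nonneg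
          by (intro mult_left_mono real_le_rsqrt) (auto simp: b_def)
        finally show "norm (mercer F (\<lambda>x. \<psi> x - ?l * \<phi> (k n) x) x) \<le> F0 * sqrt (b n)" .
      qed
      show "(\<lambda>n. F0 * sqrt (b n)) \<longlonglongrightarrow> 0"
        using tendsto_mult_left[OF tendsto_real_sqrt[OF b], of F0] by simp
    qed
    moreover have "mercer F (\<lambda>x. \<psi> x - ?l * \<phi> (k n) x) x = mercer F \<psi> x - ?l * mercer F (\<phi> (k n)) x" for n
      using mercer_lin[OF uc_integrable[OF \<psi>] uc_integrable[OF \<phi>(1)], of 1 "- ?l" "k n" x] by simp
    moreover have "(\<lambda>n. mercer F (\<phi> (k n)) x) \<longlonglongrightarrow> \<psi> x"
    proof (rule LIMSEQ_I)
      fix r :: real assume "r > 0"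
      from conv[OF this] show "\<exists>N. \<forall>n\<ge>N. norm (mercer F (\<phi> (k n)) x - \<psi> x) < r" using x by blast
    qed
    hence "(\<lambda>n. mercer F \<psi> x - ?l * mercer F (\<phi> (k n)) x) \<longlonglongrightarrow> mercer F \<psi> x - ?l * \<psi> x"
      by (intro tendsto_intros)
    ultimately show ?thesis using LIMSEQ_unique by fastforce
  qed
  \<comment> \<open>If \<open>\<psi>\<close> vanished, the \<open>\<phi>\<^sub>n\<close> themselves would tend to \<open>0\<close> in \<open>L\<^sup>2\<close>, and the values of the
    quadratic form with them, although these values tend to \<open>\<lambda> > 0\<close>.\<close>
  have "\<not> (AE x in unit_measure. \<psi> x = 0)"
  proof
    assume z: "AE x in unit_measure. \<psi> x = 0"
    have "b n = mercer_sup\<^sup>2 * l2_normsq (\<phi> (k n))" for n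
    proof -
      have "b n = (LINT x | unit_measure. mercer_sup\<^sup>2 * (cmod (\<phi> (k n) x))\<^sup>2)"
        unfolding b_def l2_normsq_def
      proof (rule integral_cong_AE)
        show "AE x in unit_measure. (cmod (\<psi> x - ?l * \<phi> (k n) x))\<^sup>2 = mercer_sup\<^sup>2 * (cmod (\<phi> (k n) x))\<^sup>2"
          using z by eventually_elim (simp add: norm_mult power_mult_distrib)
      qed (use uc_square_integrable(2)[OF ub, of n] uc_square_integrable(2)[OF \<phi>(1), of "k n"]
        in \<open>auto intro: borel_measurable_integrable\<close>)
      thus ?thesis by (simp add: l2_normsq_def)
    qed
    hence "mercer_sup * (mercer_sup - inverse (real (Suc (k n)))) \<le> b n" for n
      using mercer_form_le[OF \<phi>(1), of "k n"] q[of "k n"] pos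
        mult_left_mono[of "mercer_sup - inverse (real (Suc (k n)))" "mercer_sup * l2_normsq (\<phi> (k n))" mercer_sup]
      by (simp add: power2_eq_square mult.assoc)
    moreover have "(\<lambda>n. mercer_sup * (mercer_sup - inverse (real (Suc (k n))))) \<longlonglongrightarrow> mercer_sup * (mercer_sup - 0)"
      by (intro tendsto_intros Suck)
    ultimately have "mercer_sup * (mercer_sup - 0) \<le> 0"
      using b by (intro LIMSEQ_le) auto
    thus False using pos by (simp add: mult_le_0_iff)
  qed
  thus ?thesis
    unfolding mercer_eigenvalue_def using uc_square_integrable(1)[OF \<psi>] eig
    by (intro exI[of _ \<psi>] conjI AE_I2) auto
qed

lemma mercer_sup_largest_eigenvalue: "largest_mercer_eigenvalue F mercer_sup"
  using mercer_sup_eigenvalue mercer_eigenvalue_le_sup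
  by (simp add: largest_mercer_eigenvalue_def)

text \<open>The coefficients of \<open>\<xi>\<close> with respect to the system are its Fourier coefficients, so their square
  sum is at most the squared \<open>L\<^sup>2\<close> norm, which the embedding estimate controls.\<close>

lemma shannon_bessel_bound: "bessel_bound F (shannon_system F) mercer_sup"
  unfolding bessel_bound_def
proof
  fix \<xi> assume \<xi>: "\<xi> \<in> rkhs F"
  let ?c = "\<lambda>n. (cmod (rkhs_inner F (shannon_system F n) \<xi>))\<^sup>2"
  have c: "?c n = (cmod (l2_inner (fourier_mode n) \<xi>))\<^sup>2" for n
    by (simp add: shannon_system_def rkhs_inner_mercer[OF fourier_mode_uc \<xi>])
  have le: "sum ?c N \<le> l2_normsq \<xi>" if "finite N" for N
    unfolding c by (rule bessel_fourier[OF that rkhs_uc[OF \<xi>]])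
  have s: "?c summable_on UNIV"
    by (rule nonneg_bdd_above_summable_on) (use le in \<open>auto intro!: bdd_aboveI\<close>)
  moreover have "(\<Sum>\<^sub>\<infinity>n. ?c n) \<le> l2_normsq \<xi>"
    by (rule infsum_le_finite_sums[OF s]) (rule le)
  ultimately show "?c summable_on UNIV \<and> (\<Sum>\<^sub>\<infinity>n. ?c n) \<le> mercer_sup * (rkhs_norm F \<xi>)\<^sup>2"
    using rkhs_l2_embedding[OF \<xi>] by simp
qed

lemma shannon_bessel_frame: "bessel_frame F (shannon_system F)"
  unfolding bessel_frame_def
  using shannon_bessel_bound mercer_in_rkhs[OF fourier_mode_uc] by (auto simp: shannon_system_def)

end

theorem theorem4p1p28:
  fixes F :: "real \<Rightarrow> complex"
  assumes "continuous_on {-1<..<1} F"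
    and "positive_definite F"
  shows "\<exists>lam1. largest_mercer_eigenvalue F lam1 \<and>
           bessel_frame F (shannon_system F) \<and>
           (\<forall>\<xi>\<in>rkhs F.
              (\<lambda>n. (cmod (rkhs_inner F (shannon_system F n) \<xi>))\<^sup>2) summable_on UNIV \<and>
              (\<Sum>\<^sub>\<infinity>n. (cmod (rkhs_inner F (shannon_system F n) \<xi>))\<^sup>2) \<le> lam1 * (rkhs_norm F \<xi>)\<^sup>2)"
proof -
  interpret continuous_positive_definite F by unfold_locales (fact assms)+
  show ?thesis
    using mercer_sup_largest_eigenvalue shannon_bessel_frame shannon_bessel_bound
    unfolding bessel_bound_def by blast
qed

end
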